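(* Let $n\ge 2$, let $\Omega\subset\mathbb{R}^n$ be a bounded connected domain with smooth boundary $\partial\Omega$, let $\tau\ge 0$ and $0\le\sigma<1$ be constants, and let $\Lambda_j(\Omega)$ ($j=1,2,\dots$) be the $j$-th eigenvalue of the Neumann-type eigenvalue problem for the biharmonic operator with parameters $\tau,\sigma$ described in the context. (i) When $\tau\geq 0$ and $0\leq\sigma<1$, $$\sum_{j=1}^k \Lambda_j(\Omega)\leq(2\pi)^{4}\frac{n}{n+4}k^{\frac{n+4}{n}}\left(\frac{1}{\omega_n|\Omega|}\right)^{\frac{4}{n}}+\tau(2\pi)^{2}\frac{n}{n+2}k^{\frac{n+2}{n}}\left(\frac{1}{\omega_n|\Omega|}\right)^{\frac{2}{n}},\qquad k\geq 1.$$ (ii) When $\tau=0$ and $0\leq\sigma<1$, $$\Lambda_{k+1}(\Omega)\leq (2\pi)^{4}\left(\frac{n+4}{4\omega_n|\Omega|}\right)^{\frac{4}{n}}k^{\frac{4}{n}},\qquad k\geq 0.$$ (iii) When $\tau>0$ and $0\leq\sigma<1$, $$\Lambda_{k+1}(\Omega)\leq \inf_{r>2\pi\left(\frac{k}{\omega_n|\Omega|}\right)^{1/n}}\ \frac{n\omega_n|\Omega|\left(\frac{r^{n+4}}{n+4}+\tau\frac{r^{n+2}}{n+2}\right)}{\omega_n|\Omega| r^n-k(2\pi)^n},\qquad k\geq 0.$$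
   Context: Here $\omega_n$ is the volume of the unit ball in $\mathbb{R}^n$, $|\Omega|$ is the volume of $\Omega$, $\overline{\Delta}$, $\overline{\nabla}$, $\overline{\nabla}^2$ are the Euclidean Laplacian, gradient and Hessian, $\nu$ is the outward unit normal on $\partial\Omega$, $\mathrm{div}_{\partial\Omega}$ is the tangential (surface) divergence on $\partial\Omega$, and $(\overline{\nabla}^2u\cdot\nu)_{\partial\Omega}$ is the projection of $\overline{\nabla}^2u\cdot\nu$ to the tangent bundle of $\partial\Omega$. The eigenvalue problem, for constants $\tau\ge0$ and $\sigma\in(-1/(n-1),1)$, is $$\overline{\Delta}^2u-\tau\overline{\Delta}u=\Lambda u\ \text{ in }\Omega,$$ $$(1-\sigma)\frac{\partial^2u}{\partial\nu^2}+\sigma\overline{\Delta}u=0\ \text{ on }\partial\Omega,$$ $$\tau\frac{\partial u}{\partial\nu}-(1-\sigma)\,\mathrm{div}_{\partial\Omega}\left(\overline{\nabla}^2u\cdot\nu\right)_{\partial\Omega}-\frac{\partial\overline{\Delta}u}{\partial\nu}=0\ \text{ on }\partial\Omega.$$ It has discrete spectrum, listed with multiplicity as $0=\Lambda_1(\Omega)\le\Lambda_2(\Omega)\le\Lambda_3(\Omega)\le\cdots\uparrow+\infty$, and $$\Lambda_{k}(\Omega)=\inf_{0\neq u\in H^2(\Omega)}\left\{\frac{\int_\Omega\left[(1-\sigma)|\overline{\nabla}^2u|^2+\sigma(\overline{\Delta}u)^2+\tau|\overline{\nabla}u|^2\right]}{\int_\Omega u^2}\ \Big|\ \int_{\Omega}u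 u_j=0,\ j=1,\dots,k-1\right\},$$ where $u_j$ are (pairwise $L^2(\Omega)$-orthogonal) eigenfunctions corresponding to $\Lambda_j(\Omega)$ and $|\overline{\nabla}^2u|^2=\sum_{i,j=1}^n\left(\frac{\partial^2u}{\partial x_i\partial x_j}\right)^2$. *)

theory Defs
  imports "HOL-Analysis.Analysis"
begin

section \<open>Classical derivatives\<close>

definition partial :: "'n::finite \<Rightarrow> (real^'n \<Rightarrow> real) \<Rightarrow> real^'n \<Rightarrow> real" where
  "partial i f x = frechet_derivative f (at x) (axis i 1)"

text \<open>The functions that are \<open>k\<close> times continuously differentiable on a set. It is only used for
  open sets.\<close>

primrec Ck_on :: "nat \<Rightarrow> (real^'n::finite) set \<Rightarrow> (real^'n \<Rightarrow> real) \<Rightarrow> bool" where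
  "Ck_on 0 U f \<longleftrightarrow> continuous_on U f"
| "Ck_on (Suc k) U f \<longleftrightarrow> f differentiable_on U \<and> (\<forall>i. Ck_on k U (partial i f))"

definition smooth_on :: "(real^'n::finite) set \<Rightarrow> (real^'n \<Rightarrow> real) \<Rightarrow> bool" where
  "smooth_on U f \<longleftrightarrow> (\<forall>k. Ck_on k U f)"

definition grad :: "(real^'n::finite \<Rightarrow> real) \<Rightarrow> real^'n \<Rightarrow> real^'n" where
  "grad f x = (\<chi> i. partial i f x)"

definition hess :: "(real^'n::finite \<Rightarrow> real) \<Rightarrow> real^'n \<Rightarrow> real^'n^'n" where
  "hess f x = (\<chi> i j. partial j (partial i f) x)"

definition laplacian :: "(real^'n::finite \<Rightarrow> real) \<Rightarrow> real^'n \<Rightarrow> real" where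
  "laplacian f x = (\<Sum>i\<in>UNIV. partial i (partial i f) x)"


section \<open>Domains with smooth boundary\<close>

definition local_defining_function ::
    "(real^'n::finite) set \<Rightarrow> real^'n \<Rightarrow> (real^'n) set \<Rightarrow> (real^'n \<Rightarrow> real) \<Rightarrow> bool" where
  "local_defining_function \<Omega> p U \<rho> \<longleftrightarrow>
     open U \<and> p \<in> U \<and> smooth_on U \<rho> \<and> (\<forall>x\<in>U. grad \<rho> x \<noteq> 0) \<and> \<Omega> \<inter> U = {x\<in>U. \<rho> x < 0}"

definition smooth_boundary :: "(real^'n::finite) set \<Rightarrow> bool" where
  "smooth_boundary \<Omega> \<longleftrightarrow> (\<forall>p\<in>frontier \<Omega>. \<exists>U \<rho>. local_defining_function \<Omega> p U \<rho>)"

definition smooth_bounded_domain :: "(real^'n::finite) set \<Rightarrow> bool" where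
  "smooth_bounded_domain \<Omega> \<longleftrightarrow>
     open \<Omega> \<and> \<Omega> \<noteq> {} \<and> connected \<Omega> \<and> bounded \<Omega> \<and> smooth_boundary \<Omega>"

text \<open>At a boundary point the direction of \<open>grad \<rho>\<close> does not depend on the local defining
  function \<open>\<rho>\<close>; it points out of \<open>\<Omega>\<close> because \<open>\<rho> < 0\<close> inside.\<close>

definition outer_normal :: "(real^'n::finite) set \<Rightarrow> real^'n \<Rightarrow> real^'n" where
  "outer_normal \<Omega> p =
     (THE v. \<exists>U \<rho>. local_defining_function \<Omega> p U \<rho> \<and> v = grad \<rho> p /\<^sub>R norm (grad \<rho> p))"

definition tangential_part :: "(real^'n::finite) set \<Rightarrow> real^'n \<Rightarrow> real^'n \<Rightarrow> real^'n" where
  "tangential_part \<Omega> p v = v - (v \<bullet> outer_normal \<Omega> p) *\<^sub>R outer_normal \<Omega> p"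

text \<open>The tangential divergence \<open>\<Sum>\<^sub>a \<langle>D\<^bsub>e\<^sub>a\<^esub> X, e\<^sub>a\<rangle>\<close>, with \<open>e\<^sub>a\<close> an orthonormal basis of the
  tangent space of the boundary at \<open>p\<close>, is written as a full trace minus its normal term. A
  derivative of \<open>X\<close> within the boundary is determined only on the tangent space, but that
  difference involves nothing else.\<close>

definition surface_div :: "(real^'n::finite) set \<Rightarrow> (real^'n \<Rightarrow> real^'n) \<Rightarrow> real^'n \<Rightarrow> real" where
  "surface_div \<Omega> X p =
     (THE d. \<exists>X'. (X has_derivative X') (at p within frontier \<Omega>) \<and>
        d = (\<Sum>i\<in>UNIV. X' (axis i 1) \<bullet> axis i 1) - X' (outer_normal \<Omega> p) \<bullet> outer_normal \<Omega> p)"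


section \<open>The Sobolev space \<open>H\<^sup>2\<close>\<close>

definition L2 :: "(real^'n::finite) set \<Rightarrow> (real^'n \<Rightarrow> real) \<Rightarrow> bool" where
  "L2 \<Omega> f \<longleftrightarrow> f \<in> borel_measurable (lebesgue_on \<Omega>) \<and> integrable (lebesgue_on \<Omega>) (\<lambda>x. (f x)\<^sup>2)"

definition test_function :: "(real^'n::finite) set \<Rightarrow> (real^'n \<Rightarrow> real) \<Rightarrow> bool" where
  "test_function \<Omega> \<phi> \<longleftrightarrow>
     smooth_on UNIV \<phi> \<and> compact (closure {x. \<phi> x \<noteq> 0}) \<and> closure {x. \<phi> x \<noteq> 0} \<subseteq> \<Omega>"

definition weak_partial ::
    "(real^'n::finite) set \<Rightarrow> 'n \<Rightarrow> (real^'n \<Rightarrow> real) \<Rightarrow> (real^'n \<Rightarrow> real) \<Rightarrow> bool" where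
  "weak_partial \<Omega> i f g \<longleftrightarrow>
     (\<forall>\<phi>. test_function \<Omega> \<phi> \<longrightarrow>
        (\<integral>x. f x * partial i \<phi> x \<partial>lebesgue_on \<Omega>) = - (\<integral>x. g x * \<phi> x \<partial>lebesgue_on \<Omega>))"

text \<open>\<open>v\<close> belongs to \<open>H\<^sup>2(\<Omega>)\<close>, with weak gradient \<open>Dv\<close> and weak Hessian \<open>D2v\<close> (which are unique
  up to null sets).\<close>

definition H2_with ::
    "(real^'n::finite) set \<Rightarrow> (real^'n \<Rightarrow> real) \<Rightarrow> (real^'n \<Rightarrow> real^'n) \<Rightarrow> (real^'n \<Rightarrow> real^'n^'n) \<Rightarrow> bool"
where
  "H2_with \<Omega> v Dv D2v \<longleftrightarrow>
     L2 \<Omega> v \<and>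
     (\<forall>i. L2 \<Omega> (\<lambda>x. Dv x $ i) \<and> weak_partial \<Omega> i v (\<lambda>x. Dv x $ i)) \<and>
     (\<forall>i j. L2 \<Omega> (\<lambda>x. D2v x $ i $ j) \<and>
        weak_partial \<Omega> j (\<lambda>x. Dv x $ i) (\<lambda>x. D2v x $ i $ j))"


section \<open>The eigenvalue problem\<close>

text \<open>Solutions are \<open>C\<^sup>4\<close> up to the boundary, so that all the terms make sense pointwise; this is
  expressed by a \<open>C\<^sup>4\<close> extension to a neighbourhood of the closure. The values outside the closure
  do not matter.\<close>

definition eigenfunction ::
    "(real^'n::finite) set \<Rightarrow> real \<Rightarrow> real \<Rightarrow> real \<Rightarrow> (real^'n \<Rightarrow> real) \<Rightarrow> bool" where
  "eigenfunction \<Omega> \<tau> \<sigma> \<mu> u \<longleftrightarrow>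
     (\<exists>U. open U \<and> closure \<Omega> \<subseteq> U \<and> Ck_on 4 U u) \<and>
     (\<exists>x\<in>\<Omega>. u x \<noteq> 0) \<and>
     (\<forall>x\<in>\<Omega>. laplacian (laplacian u) x - \<tau> * laplacian u x = \<mu> * u x) \<and>
     (\<forall>x\<in>frontier \<Omega>. let \<nu> = outer_normal \<Omega> in
        (1 - \<sigma>) * (\<nu> x \<bullet> (hess u x *v \<nu> x)) + \<sigma> * laplacian u x = 0 \<and>
        \<tau> * (grad u x \<bullet> \<nu> x)
          - (1 - \<sigma>) * surface_div \<Omega> (\<lambda>y. tangential_part \<Omega> y (hess u y *v \<nu> y)) x
          - grad (laplacian u) x \<bullet> \<nu> x = 0)"

text \<open>\<open>\<Lambda> 1 \<le> \<Lambda> 2 \<le> \<dots>\<close> is the list of all eigenvalues, each repeated according to its multiplicity,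
  and \<open>u 1, u 2, \<dots>\<close> are corresponding pairwise orthogonal eigenfunctions. Indices start at 1; the
  values at index 0 are irrelevant. The last conjunct says that the \<open>u j\<close> with \<open>\<Lambda> j = \<mu>\<close> span the
  eigenspace of \<open>\<mu>\<close>, so that no eigenvalue is missing and multiplicities are right.\<close>

definition eigenvalue_list ::
    "(real^'n::finite) set \<Rightarrow> real \<Rightarrow> real \<Rightarrow> (nat \<Rightarrow> real) \<Rightarrow> (nat \<Rightarrow> real^'n \<Rightarrow> real) \<Rightarrow> bool" where
  "eigenvalue_list \<Omega> \<tau> \<sigma> \<Lambda> u \<longleftrightarrow>
     \<Lambda> 1 = 0 \<and> (\<forall>j\<ge>1. \<Lambda> j \<le> \<Lambda> (Suc j)) \<and> filterlim \<Lambda> at_top sequentially \<and>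
     (\<forall>j\<ge>1. eigenfunction \<Omega> \<tau> \<sigma> (\<Lambda> j) (u j)) \<and>
     (\<forall>i\<ge>1. \<forall>j\<ge>1. i \<noteq> j \<longrightarrow> (\<integral>x. u i x * u j x \<partial>lebesgue_on \<Omega>) = 0) \<and>
     (\<forall>\<mu> v. eigenfunction \<Omega> \<tau> \<sigma> \<mu> v \<longrightarrow>
        (\<exists>c. \<forall>x\<in>\<Omega>. v x = (\<Sum>j | j \<ge> 1 \<and> \<Lambda> j = \<mu>. c j * u j x)))"

definition energy ::
    "(real^'n::finite) set \<Rightarrow> real \<Rightarrow> real \<Rightarrow> (real^'n \<Rightarrow> real^'n) \<Rightarrow> (real^'n \<Rightarrow> real^'n^'n) \<Rightarrow> real"
where
  "energy \<Omega> \<tau> \<sigma> Dv D2v =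
     (\<integral>x. (1 - \<sigma>) * (\<Sum>i\<in>UNIV. \<Sum>j\<in>UNIV. (D2v x $ i $ j)\<^sup>2) + \<sigma> * (trace (D2v x))\<^sup>2
          + \<tau> * (norm (Dv x))\<^sup>2 \<partial>lebesgue_on \<Omega>)"

definition rayleigh_quotients ::
    "(real^'n::finite) set \<Rightarrow> real \<Rightarrow> real \<Rightarrow> (nat \<Rightarrow> real^'n \<Rightarrow> real) \<Rightarrow> nat \<Rightarrow> real set" where
  "rayleigh_quotients \<Omega> \<tau> \<sigma> u k =
     {energy \<Omega> \<tau> \<sigma> Dv D2v / (\<integral>x. (v x)\<^sup>2 \<partial>lebesgue_on \<Omega>) | v Dv D2v.
        H2_with \<Omega> v Dv D2v \<and> \<not> (AE x in lebesgue_on \<Omega>. v x = 0) \<and>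
        (\<forall>j\<in>{1..<k}. (\<integral>x. v x * u j x \<partial>lebesgue_on \<Omega>) = 0)}"

definition variational_characterization ::
    "(real^'n::finite) set \<Rightarrow> real \<Rightarrow> real \<Rightarrow> (nat \<Rightarrow> real) \<Rightarrow> (nat \<Rightarrow> real^'n \<Rightarrow> real) \<Rightarrow> bool" where
  "variational_characterization \<Omega> \<tau> \<sigma> \<Lambda> u \<longleftrightarrow> (\<forall>k\<ge>1. \<Lambda> k = Inf (rayleigh_quotients \<Omega> \<tau> \<sigma> u k))"

end

(* By the min-max principle only the variational characterization of the eigenvalues matters,
   not the equation solved by the u_j. Trial functions are real exponentials with
   frequencies z in the lattice (2 pi / L) Z^n, |z| <= r, where Omega lies in a cube of side L: they
   are orthogonal on the cube, so on Omega they satisfy Bessel's inequality, which replaces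
   Plancherel's theorem. Evaluating the form
     Q(c) = E(w_c) + Lambda_(k+1) (|c|^2 - int_Omega w_c^2)
   on the coefficient space in an orthonormal basis adapted to u_1, ..., u_k, its trace is at least
   Lambda_1 + ... + Lambda_k + (m - k) Lambda_(k+1), m being the number of frequencies. Computing the
   trace directly and letting L tend to infinity turns the lattice sums into integrals over the ball
   of radius r and gives Kroeger's inequality
     sum_(j<=k) Lambda_j + Lambda_(k+1) (a r^n - k) <= n a (r^(n+4)/(n+4) + tau r^(n+2)/(n+2)),
   a = omega_n |Omega| / (2 pi)^n. The three claims are choices of r:
   (i) a r^n = k, (ii) a r^n = k (n+4)/4, (iii) any r with a r^n > k. *)

theory Submission
  imports Defs
begin

text \<open>The obstacle is that on \<Omega> itself the trial functions are neither orthogonal nor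
  normalized, and nothing is known about their Gram matrix. The second term of Q removes it from the
  argument. Since |c|^2 - int w_c^2 >= 0 and \<Lambda>_j <= \<Lambda>_(k+1), adding that term turns
  the Rayleigh bound \<Lambda>_j int w_c^2 <= E(w_c) into \<Lambda>_j |c|^2 <= Q(c), which involves
  only the Euclidean norm of the coefficients. Orthogonality of w_c to u_1, ..., u_(j-1) amounts to
  j - 1 linear conditions on c, so what remains is finite-dimensional. The number m of frequencies
  grows like L^n, but it occurs with the same factor \<Lambda>_(k+1) in the lower bound for the
  trace and in the trace itself. It cancels there, and only m |\<Omega>| / L^n is left, which has a
  limit.\<close>

section \<open>Linear algebra: a lower bound for the trace of a quadratic form\<close>

text \<open>The \<open>l j\<close> may be linearly dependent on \<open>G\<close>, for instance when
  \<open>G\<close> has fewer than \<open>k\<close> elements, so a \<open>q i\<close> may be zero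
  instead of a unit vector. That the span of the \<open>q i\<close> contains \<open>l j\<close> is
  expressed dually: whatever is orthogonal to the first \<open>j\<close> of them is orthogonal to
  \<open>l j\<close>.\<close>

lemma gram_schmidt_functions:
  fixes l :: "nat \<Rightarrow> 'a \<Rightarrow> real"
  assumes "finite G"
  shows "\<exists>q. (\<forall>i\<in>{1..k}. (\<Sum>z\<in>G. q i z * q i z) = 1 \<or> (\<forall>z. q i z = 0)) \<and>
    (\<forall>i\<in>{1..k}. \<forall>j\<in>{1..k}. i \<noteq> j \<longrightarrow> (\<Sum>z\<in>G. q i z * q j z) = 0) \<and>
    (\<forall>j\<in>{1..k}. \<forall>c. (\<forall>i\<in>{1..j}. (\<Sum>z\<in>G. c z * q i z) = 0) \<longrightarrow> (\<Sum>z\<in>G. c z * l j z) = 0)"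
proof (induction k)
  case 0
  show ?case by simp
next
  case (Suc k)
  define ip where "ip c d = (\<Sum>z\<in>G. c z * d z)" for c d :: "'a \<Rightarrow> real"
  have ip_comm: "ip c d = ip d c" for c d by (simp add: ip_def mult.commute)
  from Suc obtain q where
    q: "(\<forall>i\<in>{1..k}. ip (q i) (q i) = 1 \<or> (\<forall>z. q i z = 0)) \<and>
      (\<forall>i\<in>{1..k}. \<forall>j\<in>{1..k}. i \<noteq> j \<longrightarrow> ip (q i) (q j) = 0) \<and>
      (\<forall>j\<in>{1..k}. \<forall>c. (\<forall>i\<in>{1..j}. ip c (q i) = 0) \<longrightarrow> ip c (l j) = 0)"
    unfolding ip_def ..
  have unit: "ip (q i) (q i) = 1 \<or> (\<forall>z. q i z = 0)" if "i \<in> {1..k}" for i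
    using q that by meson
  have orth: "ip (q i) (q j) = 0" if "i \<in> {1..k}" "j \<in> {1..k}" "i \<noteq> j" for i j
    using q that by meson
  have span: "ip c (l j) = 0" if "j \<in> {1..k}" "\<And>i. i \<in> {1..j} \<Longrightarrow> ip c (q i) = 0" for j c
    using q that by meson
  define v where "v z = l (Suc k) z - (\<Sum>i\<in>{1..k}. ip (l (Suc k)) (q i) * q i z)" for z
  have ip_v: "ip c v = ip c (l (Suc k)) - (\<Sum>i\<in>{1..k}. ip (l (Suc k)) (q i) * ip c (q i))" for c
  proof -
    have "(\<Sum>z\<in>G. c z * (\<Sum>i\<in>{1..k}. ip (l (Suc k)) (q i) * q i z))
        = (\<Sum>i\<in>{1..k}. ip (l (Suc k)) (q i) * (\<Sum>z\<in>G. c z * q i z))"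
      by (simp add: sum_distrib_left sum.swap[of _ G] mult_ac)
    then show ?thesis
      by (simp add: ip_def v_def algebra_simps sum_subtractf)
  qed
  have v_orth: "ip (q j) v = 0" if j: "j \<in> {1..k}" for j
  proof -
    have "(\<Sum>i\<in>{1..k}. ip (l (Suc k)) (q i) * ip (q j) (q i))
        = (\<Sum>i\<in>{1..k}. if i = j then ip (l (Suc k)) (q j) * ip (q j) (q j) else 0)"
      using orth j by (intro sum.cong) auto
    also have "\<dots> = ip (l (Suc k)) (q j) * ip (q j) (q j)" using j by simp
    also have "\<dots> = ip (q j) (l (Suc k))"
      using unit[OF j] by (auto simp: ip_comm) (simp_all add: ip_def)
    finally show ?thesis by (simp add: ip_v)
  qed
  have pos: "ip v v \<ge> 0" by (simp add: ip_def sum_nonneg)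
  \<comment> \<open>If \<open>l (Suc k)\<close> depends on its predecessors, the zero function is
    inserted instead of skipping the index, so that the numbering of \<open>q\<close> stays aligned
    with that of \<open>l\<close>.\<close>
  define w where "w z = (if ip v v = 0 then 0 else v z / sqrt (ip v v))" for z
  have ip_w: "ip c w = (if ip v v = 0 then 0 else ip c v / sqrt (ip v v))" for c
    by (auto simp: ip_def w_def sum_divide_distrib)
  have ip_wv: "ip c v = 0" if "ip c w = 0" for c
  proof (cases "ip v v = 0")
    case True
    then have "\<forall>z\<in>G. v z = 0"
      using assms by (auto simp: ip_def sum_nonneg_eq_0_iff)
    then show ?thesis by (simp add: ip_def)
  qed (use that in \<open>simp add: ip_w\<close>)
  define q' where "q' = q(Suc k := w)"
  have q'_old: "q' i = q i" if "i \<in> {1..k}" for i using that by (simp add: q'_def)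
  have q'_new: "q' (Suc k) = w" by (simp add: q'_def)
  have w_orth: "ip (q j) w = 0" if "j \<in> {1..k}" for j using v_orth[OF that] by (simp add: ip_w)
  have in_Suc: "i \<in> {1..Suc k} \<longleftrightarrow> i \<in> {1..k} \<or> i = Suc k" for i by auto
  have "\<forall>i\<in>{1..Suc k}. ip (q' i) (q' i) = 1 \<or> (\<forall>z. q' i z = 0)"
  proof
    fix i assume "i \<in> {1..Suc k}"
    then consider "i \<in> {1..k}" | "i = Suc k" unfolding in_Suc by blast
    then show "ip (q' i) (q' i) = 1 \<or> (\<forall>z. q' i z = 0)"
    proof cases
      case 1 then show ?thesis using unit by (simp add: q'_old)
    next
      case 2
      have "ip w w = 1" if "ip v v \<noteq> 0"
        using that pos by (simp add: ip_w ip_comm[of w v])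
      then show ?thesis using 2 by (auto simp: q'_new w_def)
    qed
  qed
  moreover have "\<forall>i\<in>{1..Suc k}. \<forall>j\<in>{1..Suc k}. i \<noteq> j \<longrightarrow> ip (q' i) (q' j) = 0"
  proof (intro ballI impI)
    fix i j assume "i \<in> {1..Suc k}" "j \<in> {1..Suc k}" "i \<noteq> j"
    then consider "i \<in> {1..k}" "j \<in> {1..k}" | "i \<in> {1..k}" "j = Suc k" | "i = Suc k" "j \<in> {1..k}"
      unfolding in_Suc by blast
    then show "ip (q' i) (q' j) = 0"
      using orth \<open>i \<noteq> j\<close> w_orth by cases (simp_all add: q'_old q'_new ip_comm[of w])
  qed
  moreover have "\<forall>j\<in>{1..Suc k}. \<forall>c. (\<forall>i\<in>{1..j}. ip c (q' i) = 0) \<longrightarrow> ip c (l j) = 0"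
  proof (intro ballI allI impI)
    fix j c assume j: "j \<in> {1..Suc k}" and c: "\<forall>i\<in>{1..j}. ip c (q' i) = 0"
    show "ip c (l j) = 0"
    proof (cases "j = Suc k")
      case False
      then have "j \<in> {1..k}" using j by auto
      moreover have "ip c (q i) = 0" if "i \<in> {1..j}" for i
        using bspec[OF c, of i] that \<open>j \<in> {1..k}\<close> q'_old[of i] by simp
      ultimately show ?thesis by (rule span)
    next
      case True
      have "ip c w = 0" using c True q'_new by force
      moreover have "ip c (q i) = 0" if "i \<in> {1..k}" for i
        using bspec[OF c, of i] that True q'_old[of i] by simp
      ultimately show ?thesis using ip_v[of c] ip_wv[of c] True by simp
    qed
  qed
  ultimately show ?case unfolding ip_def by (intro exI[of _ q'] conjI)
qed

text \<open>With \<open>P\<close> the projection orthogonal to \<open>q\<^sub>1, \<dots>, q\<^sub>k\<close>, the trace splits as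
  \<open>\<Sum>\<^sub>i B(q\<^sub>i, q\<^sub>i) + \<Sum>\<^sub>x B(P e\<^sub>x, P e\<^sub>x)\<close>, and the hypothesis applies to every term. Below, \<open>r x\<close> is
  \<open>P e\<^sub>x\<close>.\<close>

lemma sum_le_trace:
  fixes b :: "'a \<Rightarrow> 'a \<Rightarrow> real" and l :: "nat \<Rightarrow> 'a \<Rightarrow> real" and lam :: "nat \<Rightarrow> real"
  assumes G: "finite G"
    and low: "\<And>j c. j \<in> {1..Suc k} \<Longrightarrow> (\<And>i. i \<in> {1..<j} \<Longrightarrow> (\<Sum>z\<in>G. c z * l i z) = 0) \<Longrightarrow>
      lam j * (\<Sum>z\<in>G. c z * c z) \<le> (\<Sum>y\<in>G. \<Sum>z\<in>G. c y * c z * b y z)"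
    and mono: "\<And>j. j \<in> {1..k} \<Longrightarrow> lam j \<le> lam (Suc k)"
  shows "(\<Sum>j=1..k. lam j) + (real (card G) - real k) * lam (Suc k) \<le> (\<Sum>z\<in>G. b z z)"
proof -
  define ip where "ip c d = (\<Sum>z\<in>G. c z * d z)" for c d :: "'a \<Rightarrow> real"
  define B where "B c d = (\<Sum>y\<in>G. \<Sum>z\<in>G. c y * d z * b y z)" for c d
  have ip_comm: "ip c d = ip d c" for c d by (simp add: ip_def mult.commute)
  obtain q where
    q: "(\<forall>i\<in>{1..k}. ip (q i) (q i) = 1 \<or> (\<forall>z. q i z = 0)) \<and>
      (\<forall>i\<in>{1..k}. \<forall>j\<in>{1..k}. i \<noteq> j \<longrightarrow> ip (q i) (q j) = 0) \<and>
      (\<forall>j\<in>{1..k}. \<forall>c. (\<forall>i\<in>{1..j}. ip c (q i) = 0) \<longrightarrow> ip c (l j) = 0)"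
    using gram_schmidt_functions[OF G, of k l] unfolding ip_def ..
  have unit: "ip (q i) (q i) = 1 \<or> (\<forall>z. q i z = 0)" if "i \<in> {1..k}" for i
    using q that by meson
  have orth: "ip (q i) (q j) = 0" if "i \<in> {1..k}" "j \<in> {1..k}" "i \<noteq> j" for i j
    using q that by meson
  have span: "ip c (l j) = 0" if "j \<in> {1..k}" "\<And>i. i \<in> {1..j} \<Longrightarrow> ip c (q i) = 0" for j c
    using q that by meson
  have low': "lam j * ip c c \<le> B c c"
    if "j \<in> {1..Suc k}" "\<And>i. i \<in> {1..<j} \<Longrightarrow> ip c (q i) = 0" for j c
    unfolding ip_def B_def
  proof (rule low[OF that(1)])
    fix i assume i: "i \<in> {1..<j}"
    have "ip c (l i) = 0"
      by (rule span) (use i that in auto)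
    then show "(\<Sum>z\<in>G. c z * l i z) = 0" by (simp add: ip_def)
  qed
  define r where "r x = (\<lambda>z. (if z = x then 1 else 0) - (\<Sum>i\<in>{1..k}. q i x * q i z))" for x
  have ip_r: "ip (r x) (q j) = 0" if x: "x \<in> G" and j: "j \<in> {1..k}" for x j
  proof -
    have "(\<Sum>z\<in>G. (\<Sum>i\<in>{1..k}. q i x * q i z) * q j z) = (\<Sum>i\<in>{1..k}. q i x * ip (q i) (q j))"
      by (simp add: ip_def sum_distrib_left sum_distrib_right sum.swap[of _ G] mult_ac)
    also have "\<dots> = (\<Sum>i\<in>{1..k}. if i = j then q j x * ip (q j) (q j) else 0)"
      using orth j by (intro sum.cong) auto
    also have "\<dots> = q j x" using j unit[OF j] by auto
    finally have "(\<Sum>z\<in>G. (\<Sum>i\<in>{1..k}. q i x * q i z) * q j z) = q j x" .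
    moreover have "(\<Sum>z\<in>G. (if z = x then 1 else 0) * q j z) = q j x"
      using x G by (simp add: if_distrib[of "\<lambda>t. t * _"] cong: if_cong)
    ultimately show ?thesis
      by (simp add: ip_def r_def left_diff_distrib sum_subtractf)
  qed
  \<comment> \<open>The kernel \<open>\<beta>\<close> is arbitrary because the identity is needed
    twice: for \<open>b\<close>, giving the trace of the form, and for the identity matrix, giving
    the rank of the projection.\<close>
  have bilin: "(\<Sum>x\<in>G. \<Sum>y\<in>G. \<Sum>z\<in>G. r x y * r x z * \<beta> y z)
      = (\<Sum>x\<in>G. \<beta> x x) - (\<Sum>i\<in>{1..k}. \<Sum>y\<in>G. \<Sum>z\<in>G. q i y * q i z * \<beta> y z)" for \<beta>
  proof -
    have rr: "(\<Sum>x\<in>G. r x y * r x z) = (if y = z then 1 else 0) - (\<Sum>i\<in>{1..k}. q i y * q i z)"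
      if y: "y \<in> G" and z: "z \<in> G" for y z
    proof -
      \<comment> \<open>The kernel \<open>r\<close> of the projection is symmetric and idempotent,
        so the sum over \<open>x\<close> is just \<open>r y z\<close>.\<close>
      have "r x y = r y x" for x by (auto simp: r_def mult.commute)
      then have "(\<Sum>x\<in>G. r x y * r x z) = (\<Sum>x\<in>G. r y x * ((if x = z then 1 else 0) - (\<Sum>i\<in>{1..k}. q i z * q i x)))"
        by (auto simp: r_def mult_ac intro!: sum.cong)
      also have "\<dots> = r y z - (\<Sum>x\<in>G. r y x * (\<Sum>i\<in>{1..k}. q i z * q i x))"
        using z G by (simp add: right_diff_distrib sum_subtractf if_distrib[of "\<lambda>t. _ * t"] cong: if_cong)
      also have "(\<Sum>x\<in>G. r y x * (\<Sum>i\<in>{1..k}. q i z * q i x)) = (\<Sum>i\<in>{1..k}. q i z * ip (r y) (q i))"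
        by (simp add: ip_def sum_distrib_left sum_distrib_right sum.swap[of _ G] mult_ac)
      also have "\<dots> = 0" using ip_r[OF y] by simp
      finally show ?thesis by (auto simp: r_def)
    qed
    have "(\<Sum>x\<in>G. \<Sum>y\<in>G. \<Sum>z\<in>G. r x y * r x z * \<beta> y z)
        = (\<Sum>y\<in>G. \<Sum>x\<in>G. \<Sum>z\<in>G. r x y * r x z * \<beta> y z)"
      by (rule sum.swap)
    also have "\<dots> = (\<Sum>y\<in>G. \<Sum>z\<in>G. \<Sum>x\<in>G. r x y * r x z * \<beta> y z)"
      by (intro sum.cong refl sum.swap)
    also have "\<dots> = (\<Sum>y\<in>G. \<Sum>z\<in>G. (if y = z then 1 else 0) * \<beta> y z - (\<Sum>i\<in>{1..k}. q i y * q i z * \<beta> y z))"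
      by (intro sum.cong refl) (simp add: rr flip: sum_distrib_right, simp add: left_diff_distrib)
    also have "\<dots> = (\<Sum>x\<in>G. \<beta> x x) - (\<Sum>y\<in>G. \<Sum>z\<in>G. \<Sum>i\<in>{1..k}. q i y * q i z * \<beta> y z)"
      using G by (simp add: sum_subtractf if_distrib[of "\<lambda>t. t * _"] cong: if_cong)
    also have "(\<Sum>y\<in>G. \<Sum>z\<in>G. \<Sum>i\<in>{1..k}. q i y * q i z * \<beta> y z)
        = (\<Sum>y\<in>G. \<Sum>i\<in>{1..k}. \<Sum>z\<in>G. q i y * q i z * \<beta> y z)"
      by (intro sum.cong refl sum.swap)
    also have "\<dots> = (\<Sum>i\<in>{1..k}. \<Sum>y\<in>G. \<Sum>z\<in>G. q i y * q i z * \<beta> y z)"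
      by (rule sum.swap)
    finally show ?thesis .
  qed
  have trB: "(\<Sum>x\<in>G. B (r x) (r x)) = (\<Sum>x\<in>G. b x x) - (\<Sum>i\<in>{1..k}. B (q i) (q i))"
    unfolding B_def by (rule bilin)
  have ip_alt: "ip c c = (\<Sum>y\<in>G. \<Sum>z\<in>G. c y * c z * (if y = z then 1 else 0))" for c
    using G by (simp add: ip_def if_distrib[of "\<lambda>t. _ * t"] cong: if_cong)
  have trI: "(\<Sum>x\<in>G. ip (r x) (r x)) = card G - (\<Sum>i\<in>{1..k}. ip (q i) (q i))"
    unfolding ip_alt by (subst bilin) simp
  have "lam (Suc k) * (\<Sum>x\<in>G. ip (r x) (r x)) \<le> (\<Sum>x\<in>G. B (r x) (r x))"
    unfolding sum_distrib_left by (intro sum_mono low') (use ip_r in auto)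
  then have 1: "lam (Suc k) * (card G - (\<Sum>i\<in>{1..k}. ip (q i) (q i)))
      \<le> (\<Sum>x\<in>G. b x x) - (\<Sum>i\<in>{1..k}. B (q i) (q i))"
    by (simp only: trB trI)
  \<comment> \<open>Each \<open>q i\<close> is orthogonal to the earlier ones, hence admissible for
    the bound with \<open>lam i\<close>.\<close>
  have 2: "(\<Sum>i\<in>{1..k}. lam i * ip (q i) (q i)) \<le> (\<Sum>i\<in>{1..k}. B (q i) (q i))"
    by (intro sum_mono low') (use orth in auto)
  \<comment> \<open>Where \<open>q i\<close> is zero, the bounds above count
    \<open>lam (Suc k)\<close> in place of \<open>lam i\<close>. By monotonicity this is no smaller,
    so degenerate indices do no harm.\<close>
  have "ip (q i) (q i) \<le> 1" if "i \<in> {1..k}" for i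
    using unit[OF that] by (auto simp: ip_def)
  then have "(\<Sum>i\<in>{1..k}. (lam (Suc k) - lam i) * ip (q i) (q i)) \<le> (\<Sum>i\<in>{1..k}. (lam (Suc k) - lam i) * 1)"
    using mono by (intro sum_mono mult_left_mono) auto
  then have 3: "lam (Suc k) * (\<Sum>i\<in>{1..k}. ip (q i) (q i)) - (\<Sum>i\<in>{1..k}. lam i * ip (q i) (q i))
      \<le> k * lam (Suc k) - (\<Sum>i\<in>{1..k}. lam i)"
    by (simp add: left_diff_distrib sum_subtractf sum_distrib_left)
  show ?thesis using 1 2 3 by (simp add: algebra_simps)
qed

section \<open>Fourier modes on a cube\<close>

text \<open>Fubini in coordinates: \<open>lborel\<close> on a Euclidean space is the image of the
  product measure over \<open>Basis\<close>.\<close>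

lemma lborel_integral_prod:
  fixes f :: "'a::euclidean_space \<Rightarrow> real \<Rightarrow> 'b::{real_normed_field,banach,second_countable_topology}"
  assumes f: "\<And>b. b \<in> Basis \<Longrightarrow> integrable lborel (f b)"
  shows "(\<integral>x. (\<Prod>b\<in>Basis. f b (x \<bullet> b)) \<partial>lborel) = (\<Prod>b\<in>Basis. \<integral>t. f b t \<partial>lborel)"
proof -
  have [measurable]: "f b \<in> borel_measurable borel" if "b \<in> Basis" for b
    using borel_measurable_integrable[OF f[OF that]] by simp
  interpret product_sigma_finite "\<lambda>_::'a. lborel :: real measure" ..
  have "(\<integral>x. (\<Prod>b\<in>Basis. f b (x \<bullet> b)) \<partial>lborel)
      = (\<integral>g. (\<Prod>b\<in>Basis. f b ((\<Sum>c\<in>Basis. g c *\<^sub>R c) \<bullet> b)) \<partial>(\<Pi>\<^sub>M b\<in>(Basis::'a set). lborel))"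
    by (subst lborel_eq, subst integral_distr) (auto intro!: borel_measurable_prod)
  also have "\<dots> = (\<integral>g. (\<Prod>b\<in>Basis. f b (g b)) \<partial>(\<Pi>\<^sub>M b\<in>(Basis::'a set). lborel))"
    by (intro Bochner_Integration.integral_cong refl prod.cong) simp
  also have "\<dots> = (\<Prod>b\<in>Basis. \<integral>t. f b t \<partial>lborel)"
    by (rule product_integral_prod) (use f in auto)
  finally show ?thesis .
qed

text \<open>The interval holds a whole number of periods, so the primitive
  \<open>cis (a * t) / (\<i> * a)\<close> takes the same value at both ends.\<close>

lemma integral_cis_period:
  fixes L :: real
  assumes L: "L > 0" and m: "m \<noteq> (0::int)"
  shows "(\<integral>t. indicator {-L/2..L/2} t *\<^sub>R cis (2 * pi / L * of_int m * t) \<partial>lborel) = 0"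
proof -
  define a where "a = 2 * pi / L * of_int m"
  have a: "a \<noteq> 0" using assms by (simp add: a_def)
  have "((\<lambda>t. cis (a * t)) has_integral (cis (a * (L/2)) / (\<i> * a) - cis (a * (-L/2)) / (\<i> * a))) {-L/2..L/2}"
  proof (rule fundamental_theorem_of_calculus)
    show "((\<lambda>t. cis (a * t) / (\<i> * a)) has_vector_derivative cis (a * t)) (at t within {-L/2..L/2})" for t
    proof -
      have "((\<lambda>z. exp (\<i> * a * z) / (\<i> * a)) has_field_derivative exp (\<i> * a * of_real t)) (at (of_real t))"
        using a by (auto intro!: derivative_eq_intros)
      from has_vector_derivative_real_field[OF this] show ?thesis
        by (simp add: cis_conv_exp mult.assoc)
    qed
  qed (use L in auto)
  moreover have "cis (a * (L/2)) = cis (a * (-L/2))"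
  proof -
    have "a * (L/2) = a * (-L/2) + 2 * pi * of_int m" using L by (simp add: a_def field_simps)
    moreover have "cis (2 * pi * of_int m) = 1" by (rule cis_multiple_2pi) auto
    ultimately show ?thesis by (simp only: cis_mult[symmetric] mult_1_right)
  qed
  ultimately have "((\<lambda>t. cis (a * t)) has_integral 0) {-L/2..L/2}" by simp
  moreover have "integral {-L/2..L/2} (\<lambda>t. cis (a * t)) = (\<integral>t. indicator {-L/2..L/2} t *\<^sub>R cis (a * t) \<partial>lborel)"
    by (subst set_borel_integral_eq_integral(2)[symmetric])
      (auto simp: set_lebesgue_integral_def intro!: borel_integrable_atLeastAtMost' continuous_intros)
  ultimately show ?thesis unfolding a_def by (simp add: integral_unique)
qed

text \<open>The complex exponential, unlike the cosine, is a product of functions of single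
  coordinates. A coordinate with \<open>m $ i \<noteq> 0\<close> makes one factor of its integral
  vanish; the cosine is the real part.\<close>

lemma integral_cos_period_cube:
  fixes m :: "int^'n::finite" and L :: real
  assumes L: "L > 0" and m: "m \<noteq> 0"
  defines "Q \<equiv> cbox (\<chi> i. -L/2) (\<chi> i. L/2)"
  shows "(\<integral>x. indicator Q x * cos ((\<chi> i. 2 * pi / L * of_int (m $ i)) \<bullet> x) \<partial>lborel) = 0"
proof -
  define d :: "real^'n" where "d = (\<chi> i. 2 * pi / L * of_int (m $ i))"
  define f where "f b t = indicator {-L/2..L/2} t *\<^sub>R cis ((d \<bullet> b) * t)" for b :: "real^'n" and t
  have prod: "indicator Q x *\<^sub>R cis (d \<bullet> x) = (\<Prod>b\<in>Basis. f b (x \<bullet> b))" for x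
  proof -
    have "(\<Prod>b\<in>Basis. indicator {-L/2..L/2} (x \<bullet> b)) = (indicator Q x :: real)"
    proof -
      have c: "(\<chi> i. c) \<bullet> b = c" if "b \<in> Basis" for b :: "real^'n" and c :: real
        using that by (auto simp: Basis_vec_def inner_axis)
      have "x \<in> Q \<longleftrightarrow> (\<forall>b\<in>Basis. x \<bullet> b \<in> {-L/2..L/2})"
        by (auto simp: Q_def mem_box c)
      then show ?thesis by (auto simp: indicator_def prod_zero_iff)
    qed
    moreover have "(\<Prod>b\<in>Basis. cis ((d \<bullet> b) * (x \<bullet> b))) = cis (d \<bullet> x)"
      by (simp add: cis_conv_exp euclidean_inner[of d x] sum_distrib_left flip: exp_sum)
    ultimately show ?thesis
      by (simp add: f_def scaleR_conv_of_real prod.distrib flip: of_real_prod)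
  qed
  have int: "integrable lborel (f b)" for b
    unfolding f_def using borel_integrable_atLeastAtMost'[of "-L/2" "L/2" "\<lambda>t. cis ((d \<bullet> b) * t)"]
    by (simp add: set_integrable_def continuous_intros)
  obtain i where i: "m $ i \<noteq> 0" using m by (auto simp: vec_eq_iff)
  have "(\<integral>x. (\<Prod>b\<in>Basis. f b (x \<bullet> b)) \<partial>lborel) = (\<Prod>b\<in>Basis. \<integral>t. f b t \<partial>lborel)"
    by (rule lborel_integral_prod) (rule int)
  also have "\<dots> = 0"
  proof (rule prod_zero)
    have "(\<integral>t. f (axis i 1) t \<partial>lborel) = 0"
      unfolding f_def using integral_cis_period[OF L i]
      by (simp add: inner_axis d_def)
    then show "\<exists>b\<in>Basis. (\<integral>t. f b t \<partial>lborel) = 0"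
      by (intro bexI[of _ "axis i 1"]) auto
  qed simp
  finally have "(\<integral>x. indicator Q x *\<^sub>R cis (d \<bullet> x) \<partial>lborel) = 0"
    by (simp add: prod)
  moreover have "integrable lborel (\<lambda>x. indicator Q x *\<^sub>R cis (d \<bullet> x))"
    using borel_integrable_compact[of Q "\<lambda>x. cis (d \<bullet> x)"]
    by (simp add: Q_def continuous_intros)
  ultimately have "(\<integral>x. Re (indicator Q x *\<^sub>R cis (d \<bullet> x)) \<partial>lborel) = 0"
    by (simp only: integral_Re zero_complex.sel)
  then show ?thesis by (simp add: d_def)
qed

section \<open>Classical derivatives are weak derivatives\<close>

lemma integrable_indicator_cball:
  "integrable lborel (indicator (cball (c::'a::euclidean_space) r) :: _ \<Rightarrow> real)"
proof (rule integrable_real_indicator)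
  show "emeasure lborel (cball c r) < \<infinity>" by (rule emeasure_lborel_cball_finite)
qed simp

lemma has_derivative_zero_outside:
  fixes f :: "'a::real_normed_vector \<Rightarrow> 'b::real_normed_vector"
  assumes "closed K" and "\<And>y. y \<notin> K \<Longrightarrow> f y = 0" and "(f has_derivative D) (at x)" and "x \<notin> K"
  shows "D = (\<lambda>_. 0)"
proof -
  have "open (- K)" using \<open>closed K\<close> by (simp add: open_Compl)
  then have "(f has_derivative (\<lambda>_. 0)) (at x)"
    by (rule has_derivative_transform_within_open[OF has_derivative_const]) (use assms in auto)
  then show ?thesis using assms(3) has_derivative_unique by blast
qed

text \<open>The integral of a difference quotient vanishes by translation invariance; let the step tend to 0.\<close>

lemma integral_partial_compact_support:
  fixes F :: "real^'n::finite \<Rightarrow> real"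
  assumes F: "\<And>x. (F has_derivative F' x) (at x)"
    and cont: "continuous_on UNIV (\<lambda>x. F' x a)"
    and K: "compact K" and supp: "\<And>x. x \<notin> K \<Longrightarrow> F x = 0"
  shows "(\<integral>x. F' x a \<partial>lborel) = 0"
proof -
  have lin: "F' y (s *\<^sub>R a) = F' y a * s" for y s
    using linear_scale[OF has_derivative_linear[OF F]] by simp
  have contF: "continuous_on UNIV F"
    using F has_derivative_continuous continuous_at_imp_continuous_on by blast
  have D0: "F' x a = 0" if "x \<notin> K" for x
    using has_derivative_zero_outside[OF compact_imp_closed[OF K] supp F that] by simp
  obtain M where M: "\<And>x. \<bar>F' x a\<bar> \<le> M"
  proof -
    have "compact ((\<lambda>x. F' x a) ` K)"
      using K cont by (meson compact_continuous_image continuous_on_subset subset_UNIV)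
    then obtain M where "\<forall>y\<in>(\<lambda>x. F' x a) ` K. norm y \<le> M"
      using compact_imp_bounded bounded_iff by metis
    then have "\<bar>F' x a\<bar> \<le> max M 0" for x
      using D0[of x] by (cases "x \<in> K") (auto simp: max.coboundedI1)
    then show ?thesis using that by blast
  qed
  obtain R where R: "\<And>x. x \<in> K \<Longrightarrow> norm x \<le> R"
    using K compact_imp_bounded bounded_iff by metis
  \<comment> \<open>All steps \<open>t n\<close> are at most 1, so \<open>S\<close> contains the
    supports of all difference quotients. With the mean value theorem,
    \<open>M * indicator S\<close> dominates them.\<close>
  define S where "S = cball (0::real^'n) (R + norm a)"
  define t where "t n = 1 / real (Suc n)" for n
  have t: "0 < t n" "t n \<le> 1" for n by (auto simp: t_def)
  define d where "d n x = (F (x + t n *\<^sub>R a) - F x) / t n" for n x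
  have bound: "norm (d n x) \<le> M * indicator S x" for n x
  proof (cases "x \<in> S")
    case False
    then have nx: "norm x > R + norm a" by (simp add: S_def)
    have "x \<notin> K" using R[of x] nx norm_ge_zero[of a] by linarith
    moreover have "x + t n *\<^sub>R a \<notin> K"
    proof
      assume "x + t n *\<^sub>R a \<in> K"
      then have "norm (x + t n *\<^sub>R a) \<le> R" by (rule R)
      moreover have "norm x \<le> norm (x + t n *\<^sub>R a) + norm (t n *\<^sub>R a)"
        using norm_triangle_sub[of x "- (t n *\<^sub>R a)"] by simp
      moreover have "norm (t n *\<^sub>R a) \<le> norm a"
        using t[of n] mult_left_le_one_le[of "norm a" "t n"] by simp
      ultimately show False using nx by linarith
    qed
    ultimately show ?thesis using False by (simp add: d_def supp)
  next
    case True
    have "((\<lambda>s. F (x + s *\<^sub>R a)) has_derivative (\<lambda>s. F' (x + s0 *\<^sub>R a) (s *\<^sub>R a))) (at s0)" for s0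
    proof -
      have "((\<lambda>s. x + s *\<^sub>R a) has_derivative (\<lambda>s. s *\<^sub>R a)) (at s0)"
        by (auto intro!: derivative_eq_intros)
      from has_derivative_compose[OF this F] show ?thesis by simp
    qed
    then have der: "((\<lambda>s. F (x + s *\<^sub>R a)) has_real_derivative F' (x + s *\<^sub>R a) a) (at s)" for s
      unfolding has_field_derivative_def
      by (rule has_derivative_eq_rhs)
        (simp add: fun_eq_iff lin)
    obtain s where "F (x + t n *\<^sub>R a) - F (x + 0 *\<^sub>R a) = (t n - 0) * F' (x + s *\<^sub>R a) a"
      using MVT2[of 0 "t n" "\<lambda>s. F (x + s *\<^sub>R a)" "\<lambda>s. F' (x + s *\<^sub>R a) a"] t[of n] der by auto
    then have "d n x = F' (x + s *\<^sub>R a) a" using t[of n] by (simp add: d_def)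
    then show ?thesis using M True by simp
  qed
  have lim: "(\<lambda>n. d n x) \<longlonglongrightarrow> F' x a" for x
  proof -
    have "((\<lambda>s. F (x + s *\<^sub>R a)) has_derivative (\<lambda>s. F' x (s *\<^sub>R a))) (at 0)"
    proof -
      have "((\<lambda>s. x + s *\<^sub>R a) has_derivative (\<lambda>s. s *\<^sub>R a)) (at 0)"
        by (auto intro!: derivative_eq_intros)
      from has_derivative_compose[OF this F] show ?thesis by simp
    qed
    then have "((\<lambda>s. F (x + s *\<^sub>R a)) has_real_derivative F' x a) (at 0)"
      unfolding has_field_derivative_def
      by (rule has_derivative_eq_rhs)
        (simp add: fun_eq_iff lin)
    then have "((\<lambda>s. (F (x + s *\<^sub>R a) - F x) / s) \<longlongrightarrow> F' x a) (at 0)"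
      by (simp add: DERIV_def)
    moreover have "filterlim t (at 0) sequentially"
    proof (rule filterlim_atI)
      show "t \<longlonglongrightarrow> 0" unfolding t_def using LIMSEQ_inverse_real_of_nat by (simp add: inverse_eq_divide)
    qed (use t in \<open>auto intro!: always_eventually simp: less_imp_neq[symmetric]\<close>)
    ultimately show ?thesis unfolding d_def by (rule filterlim_compose)
  qed
  have Fm [measurable]: "F \<in> borel_measurable borel"
    using contF by (rule borel_measurable_continuous_onI)
  have Dm: "(\<lambda>x. F' x a) \<in> borel_measurable borel"
    using cont by (rule borel_measurable_continuous_onI)
  have "(\<lambda>n. \<integral>x. d n x \<partial>lborel) \<longlonglongrightarrow> (\<integral>x. F' x a \<partial>lborel)"
  proof (rule integral_dominated_convergence[where w = "\<lambda>x. M * indicator S x"])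
    show "integrable lborel (\<lambda>x. M * indicator S x)"
      unfolding S_def by (intro integrable_mult_right integrable_indicator_cball)
  qed (use bound lim Dm in \<open>auto simp: d_def\<close>)
  moreover have "(\<integral>x. d n x \<partial>lborel) = 0" for n
  proof -
    have int: "integrable lborel F"
    proof -
      have "integrable lborel (\<lambda>x. indicator K x *\<^sub>R F x)"
        using K contF by (intro borel_integrable_compact) (auto intro: continuous_on_subset)
      also have "(\<lambda>x. indicator K x *\<^sub>R F x) = F"
      proof
        show "indicator K x *\<^sub>R F x = F x" for x using supp by (cases "x \<in> K") auto
      qed
      finally show ?thesis .
    qed
    \<comment> \<open>Translation invariance: both terms of the difference quotient have the same
      integral.\<close>
    have "integral\<^sup>L lborel F = integral\<^sup>L (distr lborel borel ((+) (t n *\<^sub>R a))) F"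
      by (simp add: lborel_distr_plus)
    also have "\<dots> = (\<integral>x. F (x + t n *\<^sub>R a) \<partial>lborel)"
      by (subst integral_distr) (auto simp: add.commute)
    finally have eq: "(\<integral>x. F (x + t n *\<^sub>R a) \<partial>lborel) = integral\<^sup>L lborel F" by simp
    have "integrable (distr lborel borel ((+) (t n *\<^sub>R a))) F" using int by (simp add: lborel_distr_plus)
    then have "integrable lborel (\<lambda>x. F (x + t n *\<^sub>R a))"
      by (subst (asm) integrable_distr_eq) (auto simp: add.commute)
    then show ?thesis using int eq by (simp add: d_def)
  qed
  ultimately show ?thesis by (simp add: LIMSEQ_const_iff)
qed

text \<open>The product of \<open>f\<close> with a test function has compact support inside
  \<Omega>, so its derivative integrates to 0 over the whole space and no boundary term arises. The
  Leibniz rule does the rest.\<close>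

lemma weak_partial_classical:
  fixes f :: "real^'n::finite \<Rightarrow> real"
  assumes \<Omega>: "open \<Omega>" and f: "\<And>x. (f has_derivative f' x) (at x)"
    and cont: "continuous_on UNIV (\<lambda>x. f' x (axis i 1))"
  shows "weak_partial \<Omega> i f (\<lambda>x. f' x (axis i 1))"
  unfolding weak_partial_def
proof (intro allI impI)
  fix \<phi> assume "test_function \<Omega> \<phi>"
  define K where "K = closure {x. \<phi> x \<noteq> 0}"
  have sm: "smooth_on UNIV \<phi>" and K: "compact K" "K \<subseteq> \<Omega>"
    using \<open>test_function \<Omega> \<phi>\<close> by (auto simp: test_function_def K_def)
  have 1: "Ck_on (Suc 0) UNIV \<phi>" using sm by (auto simp: smooth_on_def simp del: Ck_on.simps)
  define \<phi>' where "\<phi>' x = frechet_derivative \<phi> (at x)" for x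
  have \<phi>': "(\<phi> has_derivative \<phi>' x) (at x)" for x
    using 1 by (simp add: \<phi>'_def differentiable_on_def flip: frechet_derivative_works)
  have part: "partial i \<phi> = (\<lambda>x. \<phi>' x (axis i 1))" by (simp add: partial_def \<phi>'_def fun_eq_iff)
  have c\<phi>': "continuous_on UNIV (\<lambda>x. \<phi>' x (axis i 1))" using 1 unfolding part[symmetric] Ck_on.simps by blast
  have c\<phi>: "continuous_on UNIV \<phi>" using \<phi>' has_derivative_continuous continuous_at_imp_continuous_on by blast
  have cf: "continuous_on UNIV f" using f has_derivative_continuous continuous_at_imp_continuous_on by blast
  have \<phi>0: "\<phi> x = 0" if "x \<notin> K" for x using that closure_subset[of "{x. \<phi> x \<noteq> 0}"] by (auto simp: K_def)
  have \<phi>'0: "\<phi>' x (axis i 1) = 0" if "x \<notin> K" for x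
    using has_derivative_zero_outside[OF compact_imp_closed[OF K(1)] \<phi>0 \<phi>' that] by simp
  have [measurable]: "\<Omega> \<in> sets lebesgue" using \<Omega> by (simp add: borel_open)
  \<comment> \<open>For functions that vanish off \<open>K \<subseteq> \<Omega>\<close> it makes no
    difference whether one integrates over \<Omega> or over the whole space.\<close>
  have restrict: "integral\<^sup>L (lebesgue_on \<Omega>) g = integral\<^sup>L lborel g" and intg: "integrable lborel g"
    if g: "continuous_on UNIV g" "\<And>x. x \<notin> K \<Longrightarrow> g x = 0" for g :: "real^'n \<Rightarrow> real"
  proof -
    have "integral\<^sup>L (lebesgue_on \<Omega>) g = (\<integral>x. indicator \<Omega> x *\<^sub>R g x \<partial>lebesgue)"
      by (rule integral_restrict_space) simp
    also have "(\<lambda>x. indicator \<Omega> x *\<^sub>R g x) = g"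
    proof
      show "indicator \<Omega> x *\<^sub>R g x = g x" for x using g K by (cases "x \<in> \<Omega>") auto
    qed
    also have "integral\<^sup>L lebesgue g = integral\<^sup>L lborel g"
      by (rule integral_completion) (use g in \<open>auto intro: borel_measurable_continuous_onI\<close>)
    finally show "integral\<^sup>L (lebesgue_on \<Omega>) g = integral\<^sup>L lborel g" .
    have "integrable lborel (\<lambda>x. indicator K x *\<^sub>R g x)"
      using K g by (intro borel_integrable_compact) (auto intro: continuous_on_subset)
    also have "(\<lambda>x. indicator K x *\<^sub>R g x) = g"
    proof
      show "indicator K x *\<^sub>R g x = g x" for x using g by (cases "x \<in> K") auto
    qed
    finally show "integrable lborel g" .
  qed
  have "(\<integral>x. f x * \<phi>' x (axis i 1) + f' x (axis i 1) * \<phi> x \<partial>lborel) = 0"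
    by (rule integral_partial_compact_support[OF has_derivative_mult[OF f \<phi>'] _ K(1)])
      (auto intro!: continuous_intros cf cont c\<phi> c\<phi>' simp: \<phi>0)
  moreover have "integrable lborel (\<lambda>x. f x * \<phi>' x (axis i 1))" "integrable lborel (\<lambda>x. f' x (axis i 1) * \<phi> x)"
    by (rule intg; auto intro!: continuous_intros cf cont c\<phi> c\<phi>' simp: \<phi>0 \<phi>'0)+
  ultimately have "(\<integral>x. f x * \<phi>' x (axis i 1) \<partial>lborel) = - (\<integral>x. f' x (axis i 1) * \<phi> x \<partial>lborel)"
    by simp
  moreover have "(\<integral>x. f x * \<phi>' x (axis i 1) \<partial>lebesgue_on \<Omega>) = (\<integral>x. f x * \<phi>' x (axis i 1) \<partial>lborel)"
     "(\<integral>x. f' x (axis i 1) * \<phi> x \<partial>lebesgue_on \<Omega>) = (\<integral>x. f' x (axis i 1) * \<phi> x \<partial>lborel)"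
    by (rule restrict; auto intro!: continuous_intros cf cont c\<phi> c\<phi>' simp: \<phi>0 \<phi>'0)+
  ultimately show "(\<integral>x. f x * partial i \<phi> x \<partial>lebesgue_on \<Omega>) = - (\<integral>x. f' x (axis i 1) * \<phi> x \<partial>lebesgue_on \<Omega>)"
    by (simp add: part)
qed

section \<open>Moments of balls and limits of lattice sums\<close>

text \<open>Layer cake: \<open>r\<^sup>a - |x|\<^sup>a = \<integral> a s\<^sup>a\<^sup>-\<^sup>1 ds\<close> over \<open>|x| \<le> s \<le> r\<close>, and Fubini.\<close>

lemma integral_norm_power_ball:
  fixes r :: real
  assumes r: "r \<ge> 0" and a: "a \<ge> 1"
  shows "(\<integral>x. indicator (cball 0 r) (x::'a::euclidean_space) * norm x ^ a \<partial>lborel)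
    = DIM('a) * unit_ball_vol DIM('a) * r ^ (DIM('a) + a) / (DIM('a) + a)"
proof -
  let ?n = "DIM('a)" and ?\<omega> = "unit_ball_vol DIM('a)"
  have \<omega>: "?\<omega> \<ge> 0" by simp
  have D: "DERIV (\<lambda>s. c * s ^ m / m) s :> c * s ^ (m - 1)" if "m > 0" for m :: nat and c s :: real
    using that by (auto intro!: derivative_eq_intros)
  have meas: "(\<lambda>(x::'a, s::real). ennreal (indicator {0..r} s * (a * s ^ (a - 1))) * indicator {x. norm (fst x) \<le> snd x} (x, s))
      \<in> borel_measurable (lborel \<Otimes>\<^sub>M lborel)"
    unfolding case_prod_beta by measurable
  have "(\<integral>\<^sup>+x. ennreal (indicator (cball 0 r) x * (r ^ a - norm (x::'a) ^ a)) \<partial>lborel)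
      = (\<integral>\<^sup>+x. \<integral>\<^sup>+s. ennreal (indicator {0..r} s * (a * s ^ (a - 1))) * indicator {x. norm (fst x) \<le> snd x} (x::'a, s) \<partial>lborel \<partial>lborel)"
  proof (rule nn_integral_cong)
    fix x :: 'a
    show "ennreal (indicator (cball 0 r) x * (r ^ a - norm x ^ a))
      = (\<integral>\<^sup>+s. ennreal (indicator {0..r} s * (a * s ^ (a - 1))) * indicator {x. norm (fst x) \<le> snd x} (x, s) \<partial>lborel)"
    proof (cases "norm x \<le> r")
      case True
      have "(\<integral>\<^sup>+s. ennreal (indicator {0..r} s * (a * s ^ (a - 1))) * indicator {x. norm (fst x) \<le> snd x} (x, s) \<partial>lborel)
         = (\<integral>\<^sup>+s. ennreal (a * s ^ (a - 1)) * indicator {norm x..r} s \<partial>lborel)"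
        by (intro nn_integral_cong) (auto simp: indicator_def dest: order_trans[OF norm_ge_zero])
      also have "\<dots> = ennreal (r ^ a - norm x ^ a)"
        by (rule nn_integral_FTC_Icc[where F = "\<lambda>s. s ^ a"])
          (use True in \<open>auto intro!: derivative_eq_intros mult_nonneg_nonneg zero_le_power intro: order_trans[OF norm_ge_zero]\<close>)
      finally show ?thesis using True by simp
    next
      case False
      then have "(\<lambda>s::real. ennreal (indicator {0..r} s * (a * s ^ (a - 1))) * indicator {x. norm (fst x) \<le> snd x} (x, s)) = (\<lambda>s. 0)"
        by (auto simp: indicator_def)
      then show ?thesis using False by simp
    qed
  qed
  also have "\<dots> = (\<integral>\<^sup>+s. \<integral>\<^sup>+x. ennreal (indicator {0..r} s * (a * s ^ (a - 1))) * indicator {x. norm (fst x) \<le> snd x} (x::'a, s) \<partial>lborel \<partial>lborel)"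
    using lborel_pair.Fubini[OF meas] by (simp add: case_prod_beta)
  also have "\<dots> = (\<integral>\<^sup>+s. ennreal (a * ?\<omega> * s ^ (?n + a - 1)) * indicator {0..r} s \<partial>lborel)"
  proof (rule nn_integral_cong)
    fix s :: real
    show "(\<integral>\<^sup>+x. ennreal (indicator {0..r} s * (a * s ^ (a - 1))) * indicator {x. norm (fst x) \<le> snd x} (x::'a, s) \<partial>lborel)
       = ennreal (a * ?\<omega> * s ^ (?n + a - 1)) * indicator {0..r} s"
    proof (cases "s \<in> {0..r}")
      case True
      have "(\<integral>\<^sup>+x. ennreal (indicator {0..r} s * (a * s ^ (a - 1))) * indicator {x. norm (fst x) \<le> snd x} (x::'a, s) \<partial>lborel)
        = (\<integral>\<^sup>+x. ennreal (a * s ^ (a - 1)) * indicator (cball 0 s) (x::'a) \<partial>lborel)"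
        using True by (intro nn_integral_cong) (auto simp: indicator_def)
      also have "\<dots> = ennreal (a * s ^ (a - 1)) * ennreal (?\<omega> * s ^ ?n)"
        using True by (subst nn_integral_cmult_indicator) (auto simp: emeasure_cball)
      also have "\<dots> = ennreal (a * ?\<omega> * s ^ (?n + a - 1))"
      proof -
        have "?n + a - 1 = (a - 1) + ?n" using a by simp
        then show ?thesis using True \<omega> by (simp add: power_add mult_ac flip: ennreal_mult)
      qed
      finally show ?thesis using True by simp
    qed simp
  qed
  also have "\<dots> = ennreal (a * ?\<omega> * r ^ (?n + a) / (?n + a) - a * ?\<omega> * 0 ^ (?n + a) / (?n + a))"
    by (rule nn_integral_FTC_Icc[where F = "\<lambda>s. a * ?\<omega> * s ^ (?n + a) / (?n + a)"])
      (use r a \<omega> D[of "?n + a" "a * ?\<omega>"] in \<open>auto simp: mult_ac\<close>)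
  finally have nn: "(\<integral>\<^sup>+x. ennreal (indicator (cball 0 r) x * (r ^ a - norm (x::'a) ^ a)) \<partial>lborel)
     = ennreal (a * ?\<omega> * r ^ (?n + a) / (?n + a))"
    using a by (simp add: power_0_left)
  have "integral\<^sup>L lborel (\<lambda>x. indicator (cball 0 r) x * (r ^ a - norm (x::'a) ^ a)) = a * ?\<omega> * r ^ (?n + a) / (?n + a)"
  proof (rule integral_eq_nn_integral[THEN trans])
    show "AE x in lborel. 0 \<le> indicator (cball 0 r) (x::'a) * (r ^ a - norm x ^ a)"
      by (auto simp: indicator_def power_mono)
    show "(\<lambda>x. indicator (cball 0 r) (x::'a) * (r ^ a - norm x ^ a)) \<in> borel_measurable lborel"
      by (intro borel_measurable_times borel_measurable_indicator) auto
  qed (use nn r \<omega> in auto)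
  moreover have i1: "integrable lborel (\<lambda>x. indicator (cball 0 r) (x::'a) * r ^ a)"
    by (intro integrable_mult_left integrable_indicator_cball)
  moreover have i2: "integrable lborel (\<lambda>x. indicator (cball 0 r) (x::'a) * norm x ^ a)"
    using borel_integrable_compact[of "cball 0 r" "\<lambda>x::'a. norm x ^ a"] by (simp add: continuous_intros)
  \<comment> \<open>The integral computed so far is that of the complement
    \<open>r ^ a - norm x ^ a\<close>. Subtracting it from \<open>r ^ a\<close> times the volume of
    the ball leaves the factor 1 - a/(n+a) = n/(n+a).\<close>
  ultimately have "(\<integral>x. indicator (cball 0 r) (x::'a) * norm x ^ a \<partial>lborel)
     = ?\<omega> * r ^ ?n * r ^ a - a * ?\<omega> * r ^ (?n + a) / (?n + a)"
    using Bochner_Integration.integral_diff[OF i1 i2] content_cball[OF r, of "0::'a"]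
    by (simp add: right_diff_distrib)
  also have "\<dots> = ?n * ?\<omega> * r ^ (?n + a) / (?n + a)"
    using a by (simp add: field_simps power_add)
  finally show ?thesis .
qed

text \<open>Frequencies are indexed by integer vectors, so that orthogonality is decided by equality
  of indices and \<open>p\<close> and \<open>- p\<close> can be paired. With
  \<open>h = 2*pi/L\<close> these are the frequencies that are periodic on a cube of side
  \<open>L\<close>.\<close>

definition lattice_point :: "real \<Rightarrow> int^'n::finite \<Rightarrow> real^'n" where
  "lattice_point h p = (\<chi> i. h * of_int (p $ i))"

definition lattice_ball :: "real \<Rightarrow> real \<Rightarrow> (int^'n::finite) set" where
  "lattice_ball h r = {p. norm (lattice_point h p) \<le> r}"

lemma finite_lattice_ball:
  assumes h: "h > 0"
  shows "finite (lattice_ball h r :: (int^'n::finite) set)"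
proof -
  define M where "M = \<lceil>r / h\<rceil>"
  have "lattice_ball h r \<subseteq> vec_lambda ` (PiE UNIV (\<lambda>_::'n. {-M..M}))"
  proof
    fix p :: "int^'n" assume p: "p \<in> lattice_ball h r"
    have "p $ i \<in> {-M..M}" for i
    proof -
      have "\<bar>h * of_int (p $ i)\<bar> \<le> r"
        using p component_le_norm_cart[of "lattice_point h p" i] by (simp add: lattice_ball_def lattice_point_def)
      then have "\<bar>of_int (p $ i)\<bar> \<le> r / h"
        using h by (simp add: abs_mult field_simps)
      then have "of_int \<bar>p $ i\<bar> \<le> (of_int M :: real)"
        unfolding M_def of_int_abs using le_of_int_ceiling by (rule order_trans)
      then have "\<bar>p $ i\<bar> \<le> M" by (simp only: of_int_le_iff)
      then show ?thesis by (simp add: abs_le_iff)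
    qed
    then have "vec_nth p \<in> PiE UNIV (\<lambda>_. {-M..M})" by auto
    then show "p \<in> vec_lambda ` (PiE UNIV (\<lambda>_::'n. {-M..M}))"
      by (intro image_eqI[of _ _ "vec_nth p"]) simp_all
  qed
  then show ?thesis by (rule finite_subset) (intro finite_imageI finite_PiE; simp)
qed

text \<open>The map \<open>g\<close> rounds a point down to the corner of its lattice cell, and the
  cells have volume \<open>h ^ CARD('n)\<close>. The Riemann sum is thus exactly the integral of a
  step function, to which dominated convergence can be applied.\<close>

lemma lattice_sum_eq_integral:
  fixes F :: "real^'n::finite \<Rightarrow> real"
  assumes h: "h > 0"
  defines "g \<equiv> \<lambda>x. lattice_point h (\<chi> i. \<lfloor>x $ i / h\<rfloor>)"
  shows "h ^ CARD('n) * (\<Sum>p\<in>lattice_ball h r. F (lattice_point h p))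
      = (\<integral>x. indicator (cball 0 r) (g x) * F (g x) \<partial>lborel)" (is ?A)
    and "(\<lambda>x. indicator (cball 0 r) (g x) * F (g x)) \<in> borel_measurable borel" (is ?B)
proof -
  define C where "C p = {x::real^'n. \<forall>i. h * of_int (p $ i) \<le> x $ i \<and> x $ i < h * of_int (p $ i) + h}" for p
  have C: "x \<in> C p \<longleftrightarrow> (\<chi> i. \<lfloor>x $ i / h\<rfloor>) = p" for x p
    using h by (auto simp: C_def vec_eq_iff floor_eq_iff field_simps)
  have Cm [measurable]: "C p \<in> sets borel" for p
    unfolding C_def by measurable
  \<comment> \<open>The half-open cell lies between an open and a closed box of the same
    volume.\<close>
  have em: "emeasure lborel (C p) = ennreal (h ^ CARD('n))" for p
  proof (rule antisym)
    let ?l = "lattice_point h p" and ?u = "lattice_point h p + (\<chi> i. h)"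
    have b: "(?u - ?l) \<bullet> b = h" "?l \<bullet> b \<le> ?u \<bullet> b" if "b \<in> Basis" for b
      using that h by (auto simp: Basis_vec_def inner_axis)
    have "emeasure lborel (C p) \<le> emeasure lborel (cbox ?l ?u)"
      by (rule emeasure_mono) (auto simp: C_def mem_box_cart lattice_point_def less_imp_le)
    also have "\<dots> = ennreal (h ^ CARD('n))"
      using b h by (subst emeasure_lborel_cbox) (auto simp: prod_ennreal)
    finally show "emeasure lborel (C p) \<le> ennreal (h ^ CARD('n))" .
    have "ennreal (h ^ CARD('n)) = emeasure lborel (box ?l ?u)"
      using b h by (subst emeasure_lborel_box) (auto simp: prod_ennreal)
    also have "\<dots> \<le> emeasure lborel (C p)"
      by (rule emeasure_mono) (auto simp: C_def mem_box_cart lattice_point_def less_imp_le)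
    finally show "ennreal (h ^ CARD('n)) \<le> emeasure lborel (C p)" .
  qed
  have K: "(\<lambda>x. indicator (cball 0 r) (g x) * F (g x)) = (\<lambda>x. \<Sum>p\<in>lattice_ball h r. F (lattice_point h p) * indicator (C p) x)"
  proof
    fix x :: "real^'n"
    define q where "q = (\<chi> i. \<lfloor>x $ i / h\<rfloor>)"
    have "(\<Sum>p\<in>lattice_ball h r. F (lattice_point h p) * indicator (C p) x)
      = (\<Sum>p\<in>lattice_ball h r. if q = p then F (lattice_point h p) else 0)"
      by (intro sum.cong) (auto simp: indicator_def C q_def)
    also have "\<dots> = (if q \<in> lattice_ball h r then F (lattice_point h q) else 0)"
      using finite_lattice_ball[where ?'n = 'n, OF h] by simp
    also have "\<dots> = indicator (cball 0 r) (g x) * F (g x)"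
      by (auto simp: lattice_ball_def g_def q_def indicator_def)
    finally show "indicator (cball 0 r) (g x) * F (g x) = (\<Sum>p\<in>lattice_ball h r. F (lattice_point h p) * indicator (C p) x)" ..
  qed
  show ?B unfolding K by measurable
  have "measure lborel (C p) = h ^ CARD('n)" for p
    using em h by (simp add: measure_def)
  moreover have "integrable lborel (\<lambda>x. F (lattice_point h p) * indicator (C p) x)" for p
    by (intro integrable_mult_right integrable_real_indicator) (auto simp: em)
  ultimately show ?A unfolding K
    by (simp add: sum_distrib_left mult.commute)
qed

text \<open>The step functions converge pointwise because the rounded points tend to
  \<open>x\<close>. The jump of the indicator matters only on the sphere of radius \<open>r\<close>,
  a null set.\<close>

lemma lattice_sum_tendsto:
  fixes F :: "real^'n::finite \<Rightarrow> real"
  assumes F: "continuous_on UNIV F" and h: "\<And>N. h N > 0" "h \<longlonglongrightarrow> 0"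
  shows "(\<lambda>N::nat. h N ^ CARD('n) * (\<Sum>p\<in>lattice_ball (h N) r. F (lattice_point (h N) p)))
    \<longlonglongrightarrow> (\<integral>x. indicator (cball 0 r) x * F x \<partial>lborel)"
proof -
  define g where "g N x = lattice_point (h N) (\<chi> i. \<lfloor>x $ i / h N\<rfloor>)" for N and x :: "real^'n"
  obtain M where M: "\<And>x. norm x \<le> r \<Longrightarrow> \<bar>F x\<bar> \<le> M" and M0: "M \<ge> 0"
  proof -
    have "compact (F ` cball 0 r)"
      using F by (intro compact_continuous_image) (auto intro: continuous_on_subset)
    then obtain M where "\<forall>y\<in>F ` cball 0 r. norm y \<le> M"
      using compact_imp_bounded bounded_iff by metis
    then show ?thesis using that[of "max M 0"] by force
  qed
  obtain H where H: "\<And>N. h N \<le> H"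
  proof -
    obtain H where "\<And>N. norm (h N) \<le> H"
      using h(2) convergent_imp_Bseq[of h] by (auto simp: convergent_def Bseq_def)
    then have "h N \<le> H" for N using abs_le_D1[of "h N" H] by simp
    then show ?thesis by (rule that)
  qed
  have dist: "norm (g N x - x) \<le> CARD('n) * h N" for N x
  proof -
    have "\<bar>(g N x - x) $ i\<bar> \<le> h N" for i
    proof -
      have "\<bar>of_int \<lfloor>x $ i / h N\<rfloor> - x $ i / h N\<bar> \<le> 1" by linarith
      then have "\<bar>h N * (of_int \<lfloor>x $ i / h N\<rfloor> - x $ i / h N)\<bar> \<le> h N"
        using h(1)[of N] by (simp add: abs_mult)
      then show ?thesis using h(1)[of N] by (simp add: g_def lattice_point_def right_diff_distrib)
    qed
    then have "(\<Sum>i\<in>UNIV. \<bar>(g N x - x) $ i\<bar>) \<le> (\<Sum>i\<in>(UNIV::'n set). h N)" by (rule sum_mono)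
    then show ?thesis using norm_le_l1_cart[of "g N x - x"] by simp
  qed
  \<comment> \<open>Rounding moves a point by at most \<open>CARD('n) * H\<close>, so every point
    whose cell corner lies in the ball of radius \<open>r\<close> belongs to \<open>S\<close>,
    whatever \<open>N\<close> is.\<close>
  define S where "S = cball (0::real^'n) (r + CARD('n) * H)"
  have "(\<lambda>N. \<integral>x. indicator (cball 0 r) (g N x) * F (g N x) \<partial>lborel)
    \<longlonglongrightarrow> (\<integral>x. indicator (cball 0 r) x * F x \<partial>lborel)"
  proof (rule integral_dominated_convergence[where w = "\<lambda>x. M * indicator S x"])
    show "integrable lborel (\<lambda>x. M * indicator S x)"
      unfolding S_def by (intro integrable_mult_right integrable_indicator_cball)
    show "(\<lambda>x. indicator (cball 0 r) x * F x) \<in> borel_measurable lborel"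
      using F by (intro borel_measurable_times borel_measurable_indicator) (auto intro: borel_measurable_continuous_onI)
    show "(\<lambda>x. indicator (cball 0 r) (g N x) * F (g N x)) \<in> borel_measurable lborel" for N
      using lattice_sum_eq_integral(2)[OF h(1)] unfolding g_def by simp
    have "norm (indicator (cball 0 r) (g N x) * F (g N x)) \<le> M * indicator S x" for N x
    proof (cases "norm (g N x) \<le> r")
      case True
      have "norm x \<le> norm (g N x) + norm (g N x - x)"
        using norm_triangle_sub[of x "g N x"] by (simp add: norm_minus_commute)
      also have "\<dots> \<le> r + CARD('n) * H"
        using True dist[of N x] H[of N] by (intro add_mono) (auto intro: order_trans mult_left_mono)
      finally show ?thesis using True M[OF True] by (simp add: S_def)
    next
      case False
      then show ?thesis using M0 by (auto simp: indicator_def)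
    qed
    then show "AE x in lborel. norm (indicator (cball 0 r) (g N x) * F (g N x)) \<le> M * indicator S x" for N
      by simp
    have "sphere (0::real^'n) r \<in> null_sets lborel"
      using negligible_sphere[of "0::real^'n" r] by (simp add: negligible_iff_null_sets null_sets_completion_iff)
    then have "AE x in lborel. x \<notin> sphere (0::real^'n) r" by (rule AE_not_in)
    then show "AE x in lborel. (\<lambda>N. indicator (cball 0 r) (g N x) * F (g N x)) \<longlonglongrightarrow> indicator (cball 0 r) x * F x"
    proof eventually_elim
      fix x assume x: "x \<notin> sphere (0::real^'n) r"
      have gx: "(\<lambda>N. g N x) \<longlonglongrightarrow> x"
      proof (rule LIM_zero_cancel, rule Lim_null_comparison)
        show "\<forall>\<^sub>F N in sequentially. norm (g N x - x) \<le> CARD('n) * h N" using dist by simp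
        show "(\<lambda>N. CARD('n) * h N) \<longlonglongrightarrow> 0" using tendsto_mult_right_zero[OF h(2)] by simp
      qed
      have "\<forall>\<^sub>F N in sequentially. indicator (cball 0 r) (g N x) = (indicator (cball 0 r) x :: real)"
      proof (cases "norm x < r")
        case True
        have "\<forall>\<^sub>F N in sequentially. norm (g N x) < r"
          using tendsto_norm[OF gx] True by (rule order_tendstoD)
        then show ?thesis by eventually_elim (use True in \<open>simp add: indicator_def\<close>)
      next
        case False
        then have "norm x > r" using x by (simp add: sphere_def)
        have "\<forall>\<^sub>F N in sequentially. norm (g N x) > r"
          using tendsto_norm[OF gx] \<open>norm x > r\<close> by (rule order_tendstoD)
        then show ?thesis by eventually_elim (use \<open>norm x > r\<close> in \<open>simp add: indicator_def\<close>)
      qed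
      then have "(\<lambda>N. indicator (cball 0 r) (g N x) :: real) \<longlonglongrightarrow> indicator (cball 0 r) x"
        by (rule tendsto_eventually)
      moreover have "isCont F x" using F by (simp add: continuous_on_eq_continuous_at)
      then have "(\<lambda>N. F (g N x)) \<longlonglongrightarrow> F x" using gx by (rule isCont_tendsto_compose)
      ultimately show "(\<lambda>N. indicator (cball 0 r) (g N x) * F (g N x)) \<longlonglongrightarrow> indicator (cball 0 r) x * F x"
        by (rule tendsto_mult)
    qed
  qed
  then show ?thesis unfolding g_def lattice_sum_eq_integral(1)[OF h(1)] .
qed

section \<open>Integrals over the domain and Rayleigh quotients\<close>

lemma integrable_continuous_closure:
  fixes f :: "real^'n::finite \<Rightarrow> real"
  assumes \<Omega>: "open \<Omega>" "bounded \<Omega>" and f: "continuous_on (closure \<Omega>) f"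
  shows "integrable (lebesgue_on \<Omega>) f"
    and "integral\<^sup>L (lebesgue_on \<Omega>) f = (\<integral>x. indicator \<Omega> x * f x \<partial>lborel)"
    and "integrable lborel (\<lambda>x. indicator \<Omega> x * f x)"
proof -
  have "integrable lborel (\<lambda>x. indicator (closure \<Omega>) x *\<^sub>R f x)"
    using \<Omega> f by (intro borel_integrable_compact) (auto simp: compact_closure)
  then have "integrable lborel (\<lambda>x. indicator \<Omega> x *\<^sub>R (indicator (closure \<Omega>) x *\<^sub>R f x))"
    using \<Omega> by (intro integrable_mult_indicator[of \<Omega>]) auto
  also have "(\<lambda>x. indicator \<Omega> x *\<^sub>R (indicator (closure \<Omega>) x *\<^sub>R f x)) = (\<lambda>x. indicator \<Omega> x *\<^sub>R f x)"
    using closure_subset[of \<Omega>] by (auto simp: fun_eq_iff indicator_def)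
  finally have int: "integrable lborel (\<lambda>x. indicator \<Omega> x *\<^sub>R f x)" .
  have meas: "\<Omega> \<inter> space lebesgue \<in> sets lebesgue" using \<Omega> by (simp add: borel_open)
  have "integrable lebesgue (\<lambda>x. indicator \<Omega> x *\<^sub>R f x)"
    using int by (subst integrable_completion) (auto dest: borel_measurable_integrable)
  then show "integrable (lebesgue_on \<Omega>) f"
    using meas by (simp add: integrable_restrict_space)
  have "integral\<^sup>L (lebesgue_on \<Omega>) f = (\<integral>x. indicator \<Omega> x *\<^sub>R f x \<partial>lebesgue)"
    by (rule integral_restrict_space[OF meas])
  also have "\<dots> = (\<integral>x. indicator \<Omega> x *\<^sub>R f x \<partial>lborel)"
    using int by (intro integral_completion) (auto dest: borel_measurable_integrable)
  finally show "integral\<^sup>L (lebesgue_on \<Omega>) f = (\<integral>x. indicator \<Omega> x * f x \<partial>lborel)" by simp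
  show "integrable lborel (\<lambda>x. indicator \<Omega> x * f x)" using int by simp
qed

lemma L2_continuous:
  assumes "open \<Omega>" "bounded \<Omega>" "continuous_on UNIV f"
  shows "L2 \<Omega> f"
  unfolding L2_def
  using assms
  by (intro conjI borel_measurable_integrable integrable_continuous_closure)
    (auto intro!: continuous_intros intro: continuous_on_subset)

text \<open>For \<open>\<sigma>\<close> in [0,1] every term of the integrand is nonnegative. This
  makes the set of Rayleigh quotients bounded below, so that its \<open>Inf\<close> over the reals
  is a genuine lower bound.\<close>

lemma energy_nonneg:
  assumes "0 \<le> \<tau>" "0 \<le> \<sigma>" "\<sigma> \<le> 1"
  shows "0 \<le> energy \<Omega> \<tau> \<sigma> Dv D2v"
  unfolding energy_def using assms
  by (intro Bochner_Integration.integral_nonneg add_nonneg_nonneg mult_nonneg_nonneg sum_nonneg) auto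

lemma rayleigh_bound:
  assumes \<tau>\<sigma>: "0 \<le> \<tau>" "0 \<le> \<sigma>" "\<sigma> \<le> 1"
    and v: "H2_with \<Omega> v Dv D2v" and orth: "\<And>j. j \<in> {1..<k} \<Longrightarrow> (\<integral>x. v x * u j x \<partial>lebesgue_on \<Omega>) = 0"
  shows "Inf (rayleigh_quotients \<Omega> \<tau> \<sigma> u k) * (\<integral>x. (v x)\<^sup>2 \<partial>lebesgue_on \<Omega>) \<le> energy \<Omega> \<tau> \<sigma> Dv D2v"
proof (cases "AE x in lebesgue_on \<Omega>. v x = 0")
  case True
  then have "(\<integral>x. (v x)\<^sup>2 \<partial>lebesgue_on \<Omega>) = 0"
    by (intro integral_eq_zero_AE) auto
  then show ?thesis using energy_nonneg[OF \<tau>\<sigma>] by simp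
next
  case False
  have "integrable (lebesgue_on \<Omega>) (\<lambda>x. (v x)\<^sup>2)" using v by (simp add: H2_with_def L2_def)
  then have "(\<integral>x. (v x)\<^sup>2 \<partial>lebesgue_on \<Omega>) \<noteq> 0"
    using False by (subst integral_nonneg_eq_0_iff_AE) auto
  moreover have "(\<integral>x. (v x)\<^sup>2 \<partial>lebesgue_on \<Omega>) \<ge> 0" by (rule Bochner_Integration.integral_nonneg) simp
  ultimately have pos: "(\<integral>x. (v x)\<^sup>2 \<partial>lebesgue_on \<Omega>) > 0" by linarith
  have "Inf (rayleigh_quotients \<Omega> \<tau> \<sigma> u k) \<le> energy \<Omega> \<tau> \<sigma> Dv D2v / (\<integral>x. (v x)\<^sup>2 \<partial>lebesgue_on \<Omega>)"
  proof (rule cInf_lower)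
    show "energy \<Omega> \<tau> \<sigma> Dv D2v / (\<integral>x. (v x)\<^sup>2 \<partial>lebesgue_on \<Omega>) \<in> rayleigh_quotients \<Omega> \<tau> \<sigma> u k"
      unfolding rayleigh_quotients_def using v orth False by blast
    show "bdd_below (rayleigh_quotients \<Omega> \<tau> \<sigma> u k)"
      unfolding rayleigh_quotients_def
      by (rule bdd_belowI[of _ 0]) (auto intro!: divide_nonneg_nonneg energy_nonneg \<tau>\<sigma> Bochner_Integration.integral_nonneg)
  qed
  then show ?thesis using pos by (simp add: field_simps)
qed

section \<open>Trial functions: orthogonality, energy, Bessel's inequality\<close>

text \<open>The kernel of Hartley's transform: a real substitute for \<open>exp (i z \<bullet> x)\<close> that is orthogonal
  on cubes with a single function per frequency, \<open>z\<close> and \<open>- z\<close> being different frequencies.\<close>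

definition cas :: "'a::real_inner \<Rightarrow> 'a \<Rightarrow> real" where
  "cas z x = cos (z \<bullet> x) + sin (z \<bullet> x)"

text \<open>The derivative of cos s + sin s at s = \<open>z \<bullet> x\<close>, and at the same
  time the reflection \<open>cas z (- x)\<close>. It carries the gradient term of the
  energy.\<close>

definition cas' :: "'a::real_inner \<Rightarrow> 'a \<Rightarrow> real" where
  "cas' z x = cos (z \<bullet> x) - sin (z \<bullet> x)"

lemma continuous_on_cas [continuous_intros]: "continuous_on S (cas z)" "continuous_on S (cas' z)"
  unfolding cas_def cas'_def by (intro continuous_intros)+

lemma has_derivative_cas:
  "(cas z has_derivative (\<lambda>y. cas' z x * (z \<bullet> y))) (at x)"
  "(cas' z has_derivative (\<lambda>y. - cas z x * (z \<bullet> y))) (at x)"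
  unfolding cas_def cas'_def
  by (auto intro!: derivative_eq_intros simp: algebra_simps)

text \<open>The trial functions are smooth on the whole space, so their classical gradient and
  Hessian serve as weak ones.\<close>

lemma H2_with_cas_sum:
  fixes Z :: "'a \<Rightarrow> real^'n::finite"
  assumes \<Omega>: "open \<Omega>" "bounded \<Omega>"
  shows "H2_with \<Omega> (\<lambda>x. \<Sum>p\<in>G. c p * cas (Z p) x) (\<lambda>x. \<Sum>p\<in>G. (c p * cas' (Z p) x) *\<^sub>R Z p)
    (\<lambda>x. \<chi> i j. - (\<Sum>p\<in>G. c p * cas (Z p) x * Z p $ i * Z p $ j))"
  unfolding H2_with_def
proof (intro conjI allI)
  fix i j
  show "weak_partial \<Omega> i (\<lambda>x. \<Sum>p\<in>G. c p * cas (Z p) x) (\<lambda>x. (\<Sum>p\<in>G. (c p * cas' (Z p) x) *\<^sub>R Z p) $ i)"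
  proof -
    have "((\<lambda>x. \<Sum>p\<in>G. c p * cas (Z p) x) has_derivative (\<lambda>y. \<Sum>p\<in>G. c p * (cas' (Z p) x * (Z p \<bullet> y)))) (at x)" for x
      by (intro has_derivative_sum has_derivative_mult_right has_derivative_cas)
    from weak_partial_classical[OF \<Omega>(1) this, of i] show ?thesis
      by (simp add: continuous_intros inner_axis mult_ac)
  qed
  show "weak_partial \<Omega> j (\<lambda>x. (\<Sum>p\<in>G. (c p * cas' (Z p) x) *\<^sub>R Z p) $ i)
      (\<lambda>x. (\<chi> i j. - (\<Sum>p\<in>G. c p * cas (Z p) x * Z p $ i * Z p $ j)) $ i $ j)"
  proof -
    have "((\<lambda>x. \<Sum>p\<in>G. (c p * Z p $ i) * cas' (Z p) x) has_derivative
        (\<lambda>y. \<Sum>p\<in>G. (c p * Z p $ i) * (- cas (Z p) x * (Z p \<bullet> y)))) (at x)" for x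
      by (intro has_derivative_sum has_derivative_mult_right has_derivative_cas)
    from weak_partial_classical[OF \<Omega>(1) this, of j] show ?thesis
      by (simp add: continuous_intros inner_axis mult_ac sum_negf)
  qed
qed (auto intro!: L2_continuous \<Omega> continuous_intros)

text \<open>The Hessian is a combination of the rank-one matrices \<open>Z p $ i * Z p $ j\<close>.
  Two of these have Frobenius product \<open>(Z p \<bullet> Z q)\<^sup>2\<close>, and each has trace
  \<open>(norm (Z p))\<^sup>2\<close>.\<close>

lemma energy_cas_sum:
  fixes Z :: "'a \<Rightarrow> real^'n::finite"
  assumes \<Omega>: "open \<Omega>" "bounded \<Omega>"
  shows "energy \<Omega> \<tau> \<sigma> (\<lambda>x. \<Sum>p\<in>G. (c p * cas' (Z p) x) *\<^sub>R Z p)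
      (\<lambda>x. \<chi> i j. - (\<Sum>p\<in>G. c p * cas (Z p) x * Z p $ i * Z p $ j))
    = (\<Sum>p\<in>G. \<Sum>q\<in>G. c p * c q * (\<integral>x. cas (Z p) x * cas (Z q) x * ((1 - \<sigma>) * (Z p \<bullet> Z q)\<^sup>2 + \<sigma> * ((norm (Z p))\<^sup>2 * (norm (Z q))\<^sup>2))
        + \<tau> * (cas' (Z p) x * cas' (Z q) x * (Z p \<bullet> Z q)) \<partial>lebesgue_on \<Omega>))"
proof -
  define e where "e p q x = cas (Z p) x * cas (Z q) x * ((1 - \<sigma>) * (Z p \<bullet> Z q)\<^sup>2 + \<sigma> * ((norm (Z p))\<^sup>2 * (norm (Z q))\<^sup>2))
        + \<tau> * (cas' (Z p) x * cas' (Z q) x * (Z p \<bullet> Z q))" for p q x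
  have pw: "(1 - \<sigma>) * (\<Sum>i\<in>UNIV. \<Sum>j\<in>UNIV. ((\<chi> i j. - (\<Sum>p\<in>G. c p * cas (Z p) x * Z p $ i * Z p $ j)) $ i $ j)\<^sup>2)
      + \<sigma> * (trace (\<chi> i j. - (\<Sum>p\<in>G. c p * cas (Z p) x * Z p $ i * Z p $ j)))\<^sup>2
      + \<tau> * (norm (\<Sum>p\<in>G. (c p * cas' (Z p) x) *\<^sub>R Z p))\<^sup>2
      = (\<Sum>p\<in>G. \<Sum>q\<in>G. c p * c q * e p q x)" (is "(1 - \<sigma>) * ?A + \<sigma> * ?B\<^sup>2 + \<tau> * ?C = _") for x
  proof -
    define w where "w p = c p * cas (Z p) x" for p
    have "?A = (\<Sum>i\<in>UNIV. \<Sum>j\<in>UNIV. \<Sum>p\<in>G. \<Sum>q\<in>G. w p * w q * ((Z p $ i * Z q $ i) * (Z p $ j * Z q $ j)))"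
      by (simp add: power2_eq_square sum_product w_def mult_ac)
    also have "\<dots> = (\<Sum>p\<in>G. \<Sum>i\<in>UNIV. \<Sum>j\<in>UNIV. \<Sum>q\<in>G. w p * w q * ((Z p $ i * Z q $ i) * (Z p $ j * Z q $ j)))"
      by (subst (2) sum.swap, subst sum.swap) rule
    also have "\<dots> = (\<Sum>p\<in>G. \<Sum>q\<in>G. \<Sum>i\<in>UNIV. \<Sum>j\<in>UNIV. w p * w q * ((Z p $ i * Z q $ i) * (Z p $ j * Z q $ j)))"
      by (rule sum.cong[OF refl], subst (2) sum.swap, subst sum.swap) rule
    also have "\<dots> = (\<Sum>p\<in>G. \<Sum>q\<in>G. w p * w q * (Z p \<bullet> Z q)\<^sup>2)"
    proof -
      have "(Z p \<bullet> Z q)\<^sup>2 = (\<Sum>i\<in>UNIV. \<Sum>j\<in>UNIV. (Z p $ i * Z q $ i) * (Z p $ j * Z q $ j))" for p q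
        by (simp add: inner_vec_def power2_eq_square sum_product)
      then show ?thesis by (simp add: sum_distrib_left)
    qed
    finally have A: "?A = (\<Sum>p\<in>G. \<Sum>q\<in>G. w p * w q * (Z p \<bullet> Z q)\<^sup>2)" .
    have "?B = - (\<Sum>p\<in>G. w p * (norm (Z p))\<^sup>2)"
      unfolding power2_norm_eq_inner
      by (simp add: trace_def sum_negf inner_vec_def sum_distrib_left w_def mult_ac) (rule sum.swap)
    then have B: "?B\<^sup>2 = (\<Sum>p\<in>G. \<Sum>q\<in>G. w p * w q * ((norm (Z p))\<^sup>2 * (norm (Z q))\<^sup>2))"
      by (simp add: power2_eq_square sum_product mult_ac)
    have C: "?C = (\<Sum>p\<in>G. \<Sum>q\<in>G. c p * c q * (cas' (Z p) x * cas' (Z q) x * (Z p \<bullet> Z q)))"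
      unfolding power2_norm_eq_inner by (simp add: inner_sum_left inner_sum_right sum_distrib_left inner_commute mult_ac)
    show ?thesis
      unfolding A B C e_def w_def sum_distrib_left sum.distrib[symmetric]
      by (intro sum.cong refl) (simp add: algebra_simps)
  qed
  have int: "integrable (lebesgue_on \<Omega>) (e p q)" for p q
    unfolding e_def by (intro integrable_continuous_closure \<Omega> continuous_intros)
  show ?thesis
    unfolding energy_def pw e_def[symmetric]
    by (simp add: int)
qed

lemma lborel_integral_uminus:
  fixes f :: "'a::euclidean_space \<Rightarrow> real"
  assumes "f \<in> borel_measurable borel"
  shows "(\<integral>x. f (- x) \<partial>lborel) = (\<integral>x. f x \<partial>lborel)"
proof -
  have "(lborel :: 'a measure) = distr lborel borel uminus"
    using lborel_affine[of "-1" "0 :: 'a"] by (simp add: density_1 flip: one_ennreal_def)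
  then have "(\<integral>x. f x \<partial>lborel) = (\<integral>x. f x \<partial>distr lborel borel uminus)" by simp
  also have "\<dots> = (\<integral>x. f (- x) \<partial>lborel)" using assms by (subst integral_distr) auto
  finally show ?thesis ..
qed

text \<open>With P and Q the two frequencies, the product is cos((P - Q) . x) + sin((P + Q) . x).
  The sine is odd and the cube symmetric about 0, so it drops out even when p = - q; the cosine runs
  over full periods unless p = q.\<close>

lemma cas_orthogonal:
  fixes p q :: "int^'n::finite" and L :: real
  assumes L: "L > 0"
  defines "Q \<equiv> cbox (\<chi> i. -L/2) (\<chi> i. L/2) :: (real^'n) set"
  shows "(\<integral>x. indicator Q x * (cas (lattice_point (2*pi/L) p) x * cas (lattice_point (2*pi/L) q) x) \<partial>lborel)
     = (if p = q then L ^ CARD('n) else 0)"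
proof -
  let ?P = "lattice_point (2*pi/L) p" and ?Q = "lattice_point (2*pi/L) q"
  have diff: "?P - ?Q = (\<chi> i. 2 * pi / L * of_int ((p - q) $ i))"
    by (simp add: lattice_point_def vec_eq_iff right_diff_distrib diff_divide_distrib)
  have eq: "cas ?P x * cas ?Q x = cos ((?P - ?Q) \<bullet> x) + sin ((?P + ?Q) \<bullet> x)" for x
    by (simp add: cas_def inner_diff_left inner_add_left cos_diff sin_add algebra_simps)
  have int: "integrable lborel (\<lambda>x. indicator Q x * cos ((?P - ?Q) \<bullet> x))"
      "integrable lborel (\<lambda>x. indicator Q x * sin ((?P + ?Q) \<bullet> x))"
    using borel_integrable_compact[of Q "\<lambda>x. cos ((?P - ?Q) \<bullet> x)"] borel_integrable_compact[of Q "\<lambda>x. sin ((?P + ?Q) \<bullet> x)"]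
    by (simp_all add: Q_def continuous_intros)
  have "- x \<in> Q \<longleftrightarrow> x \<in> Q" for x by (auto simp: Q_def mem_box_cart minus_le_iff le_minus_iff)
  then have "(\<integral>x. indicator Q x * sin ((?P + ?Q) \<bullet> x) \<partial>lborel) = (\<integral>x. - (indicator Q x * sin ((?P + ?Q) \<bullet> x)) \<partial>lborel)"
    using borel_measurable_integrable[OF int(2)]
    by (subst lborel_integral_uminus[symmetric]) (auto simp: indicator_def intro!: Bochner_Integration.integral_cong)
  then have sin0: "(\<integral>x. indicator Q x * sin ((?P + ?Q) \<bullet> x) \<partial>lborel) = 0" by simp
  have "(\<integral>x. indicator Q x * cos ((?P - ?Q) \<bullet> x) \<partial>lborel) = (if p = q then L ^ CARD('n) else 0)"
  proof (cases "p = q")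
    case True
    have c: "((\<chi> i. L/2) - (\<chi> i. -L/2)) \<bullet> b = L" "(\<chi> i. -L/2) \<bullet> b \<le> (\<chi> i. L/2) \<bullet> b" if "b \<in> Basis" for b :: "real^'n"
      using that L by (auto simp: Basis_vec_def inner_axis)
    have "measure lborel Q = L ^ CARD('n)"
      unfolding Q_def using c by (subst measure_lborel_cbox_eq) auto
    then show ?thesis using True by simp
  next
    case False
    then have "p - q \<noteq> 0" by simp
    from integral_cos_period_cube[OF L this] show ?thesis using False unfolding Q_def diff by simp
  qed
  then show ?thesis using sin0 int by (simp add: eq distrib_left)
qed

text \<open>Enlarging \<Omega> to the cube can only increase the integral of a square, and on the
  cube the mixed terms vanish.\<close>

lemma bessel_cas:
  fixes c :: "int^'n::finite \<Rightarrow> real"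
  assumes L: "L > 0" and \<Omega>: "open \<Omega>" "\<Omega> \<subseteq> cbox (\<chi> i. -L/2) (\<chi> i. L/2)" and G: "finite G"
  shows "(\<integral>x. (\<Sum>p\<in>G. c p * cas (lattice_point (2*pi/L) p) x)\<^sup>2 \<partial>lebesgue_on \<Omega>) \<le> L ^ CARD('n) * (\<Sum>p\<in>G. c p * c p)"
proof -
  let ?Q = "cbox (\<chi> i. -L/2) (\<chi> i. L/2) :: (real^'n) set"
  define e where "e p x = cas (lattice_point (2*pi/L) p) x" for p :: "int^'n" and x
  have cont: "continuous_on S (e p)" for S p unfolding e_def by (intro continuous_intros)
  have bd: "bounded \<Omega>" using \<Omega>(2) bounded_cbox bounded_subset by blast
  have int: "integrable lborel (\<lambda>x. indicator ?Q x * f x)" if "continuous_on UNIV f" for f :: "real^'n \<Rightarrow> real"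
    using borel_integrable_compact[of ?Q f] that by (simp add: continuous_on_subset)
  have contw: "continuous_on S (\<lambda>x. (\<Sum>p\<in>G. c p * e p x)\<^sup>2)" for S by (intro continuous_intros cont)
  have "(\<integral>x. (\<Sum>p\<in>G. c p * e p x)\<^sup>2 \<partial>lebesgue_on \<Omega>) = (\<integral>x. indicator \<Omega> x * (\<Sum>p\<in>G. c p * e p x)\<^sup>2 \<partial>lborel)"
    by (rule integrable_continuous_closure(2)[OF \<Omega>(1) bd contw])
  also have "\<dots> \<le> (\<integral>x. indicator ?Q x * (\<Sum>p\<in>G. c p * e p x)\<^sup>2 \<partial>lborel)"
    by (rule integral_mono[OF integrable_continuous_closure(3)[OF \<Omega>(1) bd contw] int[OF contw]])
      (use \<Omega>(2) in \<open>auto simp: indicator_def\<close>)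
  also have "\<dots> = (\<integral>x. (\<Sum>p\<in>G. \<Sum>q\<in>G. c p * c q * (indicator ?Q x * (e p x * e q x))) \<partial>lborel)"
  proof -
    have "(\<Sum>p\<in>G. c p * e p x)\<^sup>2 = (\<Sum>p\<in>G. \<Sum>q\<in>G. c p * c q * (e p x * e q x))" for x
      by (simp add: power2_eq_square sum_product mult_ac)
    then show ?thesis by (simp add: sum_distrib_left mult.left_commute)
  qed
  also have "\<dots> = (\<Sum>p\<in>G. \<Sum>q\<in>G. c p * c q * (\<integral>x. indicator ?Q x * (e p x * e q x) \<partial>lborel))"
    using int[OF continuous_on_mult[OF cont cont]] by simp
  also have "\<dots> = (\<Sum>p\<in>G. \<Sum>q\<in>G. if p = q then c p * c q * L ^ CARD('n) else 0)"
    unfolding e_def cas_orthogonal[OF L] by (intro sum.cong refl) auto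
  also have "\<dots> = L ^ CARD('n) * (\<Sum>p\<in>G. c p * c p)"
    using G by (simp add: sum_distrib_left mult_ac)
  finally show ?thesis unfolding e_def .
qed

section \<open>Kroeger's inequality, first on a lattice and then in the limit\<close>

lemma sum_odd_eq_0:
  fixes f :: "'a::group_add \<Rightarrow> real"
  assumes "\<And>p. p \<in> G \<Longrightarrow> - p \<in> G" and "\<And>p. f (- p) = - f p"
  shows "sum f G = 0"
proof -
  have "sum f G = (\<Sum>p\<in>G. f (- p))"
    by (rule sum.reindex_bij_witness[of _ uminus uminus]) (use assms in auto)
  then show ?thesis by (simp add: assms sum_negf)
qed

lemma kroeger_lattice:
  fixes \<Omega> :: "(real^'n::finite) set" and \<Lambda> :: "nat \<Rightarrow> real" and L r \<tau> \<sigma> :: real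
  assumes \<tau>\<sigma>: "0 \<le> \<tau>" "0 \<le> \<sigma>" "\<sigma> \<le> 1"
    and L: "L > 0" and \<Omega>: "open \<Omega>" "\<Omega> \<subseteq> cbox (\<chi> i. -L/2) (\<chi> i. L/2)"
    and var: "\<And>j. j \<in> {1..Suc k} \<Longrightarrow> \<Lambda> j = Inf (rayleigh_quotients \<Omega> \<tau> \<sigma> u j)"
    and mono: "\<And>j. j \<in> {1..k} \<Longrightarrow> \<Lambda> j \<le> \<Lambda> (Suc k)"
    and u: "\<And>j. j \<in> {1..k} \<Longrightarrow> continuous_on (closure \<Omega>) (u j)"
  defines "G \<equiv> lattice_ball (2*pi/L) r :: (int^'n) set"
  shows "(\<Sum>j=1..k. \<Lambda> j) + \<Lambda> (Suc k) * (measure lebesgue \<Omega> * card G / L ^ CARD('n) - k)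
    \<le> measure lebesgue \<Omega> / L ^ CARD('n) *
      (\<Sum>p\<in>G. norm (lattice_point (2*pi/L) p) ^ 4 + \<tau> * (norm (lattice_point (2*pi/L) p))\<^sup>2)"
proof -
  define z :: "int^'n \<Rightarrow> real^'n" where "z = lattice_point (2*pi/L)"
  define V where "V = measure lebesgue \<Omega>"
  define S where "S p q = (\<integral>x. cas (z p) x * cas (z q) x \<partial>lebesgue_on \<Omega>)" for p q
  define T where "T p q = (\<integral>x. cas (z p) x * cas (z q) x * ((1 - \<sigma>) * (z p \<bullet> z q)\<^sup>2 + \<sigma> * ((norm (z p))\<^sup>2 * (norm (z q))\<^sup>2))
        + \<tau> * (cas' (z p) x * cas' (z q) x * (z p \<bullet> z q)) \<partial>lebesgue_on \<Omega>)" for p q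
  define l where "l i p = (\<integral>x. cas (z p) x * u i x \<partial>lebesgue_on \<Omega>)" for i p
  \<comment> \<open>The kernel of Q. Division by \<open>L ^ CARD('n)\<close>, the squared norm of
    each trial function on the cube, normalizes them.\<close>
  define B where "B p q = (T p q + \<Lambda> (Suc k) * ((if p = q then L ^ CARD('n) else 0) - S p q)) / L ^ CARD('n)" for p q
  have bd: "bounded \<Omega>" using \<Omega>(2) bounded_cbox bounded_subset by blast
  have G: "finite G" unfolding G_def using L by (intro finite_lattice_ball) simp
  have Ln: "L ^ CARD('n) > 0" using L by simp
  have int: "integrable (lebesgue_on \<Omega>) f" if "continuous_on (closure \<Omega>) f" for f :: "real^'n \<Rightarrow> real"
    using integrable_continuous_closure(1)[OF \<Omega>(1) bd that] .

  have "\<Lambda> j * (\<Sum>p\<in>G. c p * c p) \<le> (\<Sum>p\<in>G. \<Sum>q\<in>G. c p * c q * B p q)"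
    if j: "j \<in> {1..Suc k}" and orth: "\<And>i. i \<in> {1..<j} \<Longrightarrow> (\<Sum>p\<in>G. c p * l i p) = 0" for j c
  proof -
    define w where "w x = (\<Sum>p\<in>G. c p * cas (z p) x)" for x
    define I where "I = (\<integral>x. (w x)\<^sup>2 \<partial>lebesgue_on \<Omega>)"
    define C where "C = (\<Sum>p\<in>G. c p * c p)"
    define E where "E = (\<Sum>p\<in>G. \<Sum>q\<in>G. c p * c q * T p q)"
    have I: "I = (\<Sum>p\<in>G. \<Sum>q\<in>G. c p * c q * S p q)"
    proof -
      have "(w x)\<^sup>2 = (\<Sum>p\<in>G. \<Sum>q\<in>G. c p * c q * (cas (z p) x * cas (z q) x))" for x
        by (simp add: w_def power2_eq_square sum_product mult_ac)
      then show ?thesis by (simp add: I_def S_def int continuous_intros)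
    qed
    have wu: "(\<integral>x. w x * u i x \<partial>lebesgue_on \<Omega>) = 0" if i: "i \<in> {1..<j}" for i
    proof -
      have "i \<in> {1..k}" using i j by auto
      then have "(\<integral>x. w x * u i x \<partial>lebesgue_on \<Omega>) = (\<Sum>p\<in>G. c p * l i p)"
        by (simp add: w_def l_def sum_distrib_right mult.assoc int continuous_intros u)
      then show ?thesis using orth[OF i] by simp
    qed
    have "\<Lambda> j * I \<le> E"
      unfolding I_def E_def T_def w_def energy_cas_sum[OF \<Omega>(1) bd, symmetric] var[OF j]
      by (rule rayleigh_bound[OF \<tau>\<sigma> H2_with_cas_sum[OF \<Omega>(1) bd]]) (use wu in \<open>simp add: w_def\<close>)
    moreover have "I \<le> L ^ CARD('n) * C"
      unfolding I_def w_def z_def C_def by (rule bessel_cas[OF L \<Omega> G])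
    moreover have "\<Lambda> j \<le> \<Lambda> (Suc k)" using mono[of j] j by (cases "j = Suc k") auto
    \<comment> \<open>Split L^n C = I + (L^n C - I): the first part is controlled by the energy. The
      second is nonnegative by Bessel's inequality, so its factor \<open>\<Lambda> j\<close> may be
      raised to \<open>\<Lambda> (Suc k)\<close>.\<close>
    ultimately have "\<Lambda> j * (L ^ CARD('n) * C) \<le> E + \<Lambda> (Suc k) * (L ^ CARD('n) * C - I)"
      using mult_right_mono[of "\<Lambda> j" "\<Lambda> (Suc k)" "L ^ CARD('n) * C - I"] by (simp add: right_diff_distrib)
    then have "\<Lambda> j * C \<le> (E + \<Lambda> (Suc k) * (L ^ CARD('n) * C - I)) / L ^ CARD('n)"
      using Ln by (simp add: pos_le_divide_eq mult_ac)
    also have "\<dots> = (\<Sum>p\<in>G. \<Sum>q\<in>G. c p * c q * B p q)"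
    proof -
      have "L ^ CARD('n) * C = (\<Sum>p\<in>G. \<Sum>q\<in>G. c p * c q * (if p = q then L ^ CARD('n) else 0))"
        using G by (simp add: C_def sum_distrib_left if_distrib[of "\<lambda>t. _ * t"] mult_ac cong: if_cong)
      then show ?thesis unfolding I E_def B_def
        by (simp add: sum_distrib_left sum_divide_distrib flip: sum.distrib sum_subtractf)
          (simp add: field_simps cong: if_cong)
    qed
    finally show ?thesis by (simp add: C_def)
  qed
  from sum_le_trace[where b = B and lam = \<Lambda> and l = l and k = k, OF G this mono]
  have trace: "(\<Sum>j=1..k. \<Lambda> j) + (real (card G) - real k) * \<Lambda> (Suc k) \<le> (\<Sum>p\<in>G. B p p)"
    by blast

  \<comment> \<open>\<open>s\<close> is odd and \<open>G = - G\<close>, so it does not contribute to the trace.\<close>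
  define s where "s p = (\<integral>x. sin (2 * (z p \<bullet> x)) \<partial>lebesgue_on \<Omega>)" for p
  have V: "V = (\<integral>x. 1 \<partial>lebesgue_on \<Omega>)"
    unfolding V_def using integrable_continuous_closure(2)[OF \<Omega>(1) bd, of "\<lambda>_. 1"] \<Omega>(1) by simp
  have S: "S p p = V + s p" for p
  proof -
    have "cas (z p) x * cas (z p) x = 1 + sin (2 * (z p \<bullet> x))" for x
      using sin_cos_squared_add[of "z p \<bullet> x"] by (simp add: cas_def sin_double power2_eq_square algebra_simps)
    then show ?thesis
      unfolding S_def V s_def by (simp add: int continuous_intros)
  qed
  \<comment> \<open>On the diagonal the two Hessian terms combine to (1 - \<open>\<sigma>\<close>)
    |z|^4 + \<open>\<sigma>\<close> |z|^4 = |z|^4, which is why \<open>\<sigma>\<close> is absent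
    from the final bounds. The sign of \<open>s p\<close> differs in the gradient term because the
    square of \<open>cas'\<close> is 1 - sin.\<close>
  have T: "T p p = V * (norm (z p) ^ 4 + \<tau> * (norm (z p))\<^sup>2) + (norm (z p) ^ 4 - \<tau> * (norm (z p))\<^sup>2) * s p" for p
  proof -
    have sq: "cas (z p) x * cas (z p) x = 1 + sin (2 * (z p \<bullet> x))"
      "cas' (z p) x * cas' (z p) x = 1 - sin (2 * (z p \<bullet> x))" for x
      using sin_cos_squared_add[of "z p \<bullet> x"] by (simp_all add: cas_def cas'_def sin_double power2_eq_square algebra_simps)
    have "T p p = (\<integral>x. (norm (z p) ^ 4 + \<tau> * (norm (z p))\<^sup>2) * 1 + (norm (z p) ^ 4 - \<tau> * (norm (z p))\<^sup>2) * sin (2 * (z p \<bullet> x)) \<partial>lebesgue_on \<Omega>)"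
      unfolding T_def sq
      by (intro Bochner_Integration.integral_cong refl)
        (simp add: dot_square_norm power4_eq_xxxx power2_eq_square algebra_simps)
    also have "\<dots> = (norm (z p) ^ 4 + \<tau> * (norm (z p))\<^sup>2) * V + (norm (z p) ^ 4 - \<tau> * (norm (z p))\<^sup>2) * s p"
      unfolding V s_def
      by (subst Bochner_Integration.integral_add) (simp_all add: int continuous_intros)
    finally show ?thesis by (simp add: mult_ac)
  qed
  have z_minus: "z (- p) = - z p" for p by (simp add: z_def lattice_point_def vec_eq_iff)
  have G_minus: "- p \<in> G" if "p \<in> G" for p
    using that z_minus[of p] by (simp add: G_def lattice_ball_def z_def)
  have s_minus: "s (- p) = - s p" for p by (simp add: s_def z_minus)
  have sumS: "(\<Sum>p\<in>G. S p p) = card G * V"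
    using sum_odd_eq_0[of G s, OF G_minus s_minus] by (simp add: S sum.distrib)
  have sumT: "(\<Sum>p\<in>G. T p p) = V * (\<Sum>p\<in>G. norm (z p) ^ 4 + \<tau> * (norm (z p))\<^sup>2)"
    using sum_odd_eq_0[of G "\<lambda>p. (norm (z p) ^ 4 - \<tau> * (norm (z p))\<^sup>2) * s p", OF G_minus]
    by (simp add: T sum.distrib s_minus z_minus sum_distrib_left distrib_left)
  have "(\<Sum>p\<in>G. B p p) = ((\<Sum>p\<in>G. T p p) + \<Lambda> (Suc k) * (card G * L ^ CARD('n) - (\<Sum>p\<in>G. S p p))) / L ^ CARD('n)"
    unfolding B_def by (simp add: sum.distrib sum_subtractf flip: sum_divide_distrib sum_distrib_left)
  also have "\<dots> = V / L ^ CARD('n) * (\<Sum>p\<in>G. norm (z p) ^ 4 + \<tau> * (norm (z p))\<^sup>2)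
      + \<Lambda> (Suc k) * card G - \<Lambda> (Suc k) * (V * card G / L ^ CARD('n))"
    using Ln L by (simp add: sumS sumT add_divide_distrib diff_divide_distrib right_diff_distrib mult_ac)
  \<comment> \<open>The summand \<open>\<Lambda> (Suc k) * card G\<close> occurs on both sides and
    cancels.\<close>
  finally show ?thesis
    using trace unfolding V_def z_def by (simp add: algebra_simps)
qed

lemma kroeger_bound:
  fixes \<Omega> :: "(real^'n::finite) set" and \<Lambda> :: "nat \<Rightarrow> real" and r \<tau> \<sigma> :: real
  assumes \<tau>\<sigma>: "0 \<le> \<tau>" "0 \<le> \<sigma>" "\<sigma> \<le> 1" and \<Omega>: "open \<Omega>" "bounded \<Omega>"
    and var: "\<And>j. j \<in> {1..Suc k} \<Longrightarrow> \<Lambda> j = Inf (rayleigh_quotients \<Omega> \<tau> \<sigma> u j)"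
    and mono: "\<And>j. j \<in> {1..k} \<Longrightarrow> \<Lambda> j \<le> \<Lambda> (Suc k)"
    and u: "\<And>j. j \<in> {1..k} \<Longrightarrow> continuous_on (closure \<Omega>) (u j)"
    and r: "r \<ge> 0"
  defines "n \<equiv> CARD('n)"
  defines "a \<equiv> unit_ball_vol (real n) * measure lebesgue \<Omega> / (2*pi) ^ n"
  shows "(\<Sum>j=1..k. \<Lambda> j) + \<Lambda> (Suc k) * (a * r ^ n - k)
    \<le> a * n * (r ^ (n + 4) / (n + 4) + \<tau> * (r ^ (n + 2) / (n + 2)))"
proof -
  obtain L0 where L0: "L0 > 0" "\<Omega> \<subseteq> cbox (\<chi> i. -L0/2) (\<chi> i. L0/2)"
  proof -
    obtain b where b: "\<And>x. x \<in> \<Omega> \<Longrightarrow> norm x \<le> b" using \<Omega>(2) bounded_iff by metis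
    have "x \<in> cbox (\<chi> i. -(2 * (\<bar>b\<bar> + 1))/2) (\<chi> i. 2 * (\<bar>b\<bar> + 1)/2)" if "x \<in> \<Omega>" for x
    proof -
      have "\<bar>x $ i\<bar> \<le> \<bar>b\<bar> + 1" for i
        using component_le_norm_cart[of x i] b[OF that] by linarith
      then have "- (2 * (\<bar>b\<bar> + 1)) / 2 \<le> x $ i \<and> x $ i \<le> 2 * (\<bar>b\<bar> + 1) / 2" for i
        using abs_le_iff[of "x $ i" "\<bar>b\<bar> + 1"] by auto
      then show ?thesis by (simp only: mem_box_cart vec_lambda_beta) simp
    qed
    then have "\<Omega> \<subseteq> cbox (\<chi> i. -(2 * (\<bar>b\<bar> + 1))/2) (\<chi> i. 2 * (\<bar>b\<bar> + 1)/2)" by blast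
    then show ?thesis by (rule that[rotated]) simp
  qed
  \<comment> \<open>All these cubes contain \<Omega>, so the lattice inequality holds for every
    \<open>N\<close> while the mesh \<open>h N\<close> tends to 0.\<close>
  define L where "L N = L0 + real N" for N
  have L: "L N > 0" and LL0: "L0 \<le> L N" for N using L0(1) by (simp_all add: L_def)
  have box: "\<Omega> \<subseteq> cbox (\<chi> i. - L N/2) (\<chi> i. L N/2)" for N
  proof
    fix x assume "x \<in> \<Omega>"
    then have "- L0/2 \<le> x $ i \<and> x $ i \<le> L0/2" for i using L0(2) by (auto simp: mem_box_cart)
    then have "- L N/2 \<le> x $ i \<and> x $ i \<le> L N/2" for i using LL0[of N] by (smt (verit) divide_right_mono)
    then show "x \<in> cbox (\<chi> i. - L N/2) (\<chi> i. L N/2)" by (simp add: mem_box_cart)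
  qed
  define h where "h N = 2 * pi / L N" for N
  have h: "h N > 0" for N using L by (simp add: h_def)
  have h0: "h \<longlonglongrightarrow> 0"
    unfolding h_def L_def
    by (intro tendsto_divide_0[OF tendsto_const] filterlim_at_top_imp_at_infinity
        filterlim_tendsto_add_at_top[OF tendsto_const] filterlim_real_sequentially)
  define V where "V = measure lebesgue \<Omega>"
  \<comment> \<open>The normalization 1/L^n is, up to (2 pi)^n, the cell volume of the frequency
    lattice. This is the origin of the powers of 2 pi in the bounds.\<close>
  have hL: "1 / L N ^ n = h N ^ n / (2*pi) ^ n" for N
    using L[of N] by (simp add: h_def power_divide)
  have int: "integrable lborel (\<lambda>x. indicator (cball 0 r) x * norm (x::real^'n) ^ m)" for m
    using borel_integrable_compact[of "cball 0 r" "\<lambda>x::real^'n. norm x ^ m"] by (simp add: continuous_intros)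
  have "(\<lambda>N. h N ^ n * (\<Sum>p\<in>(lattice_ball (h N) r :: (int^'n) set). (1::real)))
      \<longlonglongrightarrow> (\<integral>x. indicator (cball (0::real^'n) r) x * 1 \<partial>lborel)"
    unfolding n_def by (rule lattice_sum_tendsto[where F = "\<lambda>_::real^'n. 1"]) (use h h0 in auto)
  then have lim1: "(\<lambda>N. h N ^ n * card (lattice_ball (h N) r :: (int^'n) set)) \<longlonglongrightarrow> unit_ball_vol n * r ^ n"
    using r by (simp add: content_cball n_def)
  define F where "F x = norm x ^ 4 + \<tau> * (norm x)\<^sup>2" for x :: "real^'n"
  have "(\<lambda>N. h N ^ n * (\<Sum>p\<in>lattice_ball (h N) r. F (lattice_point (h N) p)))
      \<longlonglongrightarrow> (\<integral>x. indicator (cball 0 r) x * F x \<partial>lborel)"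
    unfolding n_def by (rule lattice_sum_tendsto) (use h h0 in \<open>auto simp: F_def intro!: continuous_intros\<close>)
  moreover have "(\<integral>x. indicator (cball 0 r) x * F x \<partial>lborel)
      = n * unit_ball_vol n * (r ^ (n + 4) / (n + 4) + \<tau> * (r ^ (n + 2) / (n + 2)))"
  proof -
    have "(\<integral>x. indicator (cball 0 r) x * F x \<partial>lborel)
      = (\<integral>x. indicator (cball 0 r) x * norm (x::real^'n) ^ 4 \<partial>lborel) + \<tau> * (\<integral>x. indicator (cball 0 r) x * norm (x::real^'n) ^ 2 \<partial>lborel)"
      using int[of 4] int[of 2] by (simp add: F_def distrib_left mult.left_commute[of _ \<tau>])
    also have "\<dots> = n * unit_ball_vol n * r ^ (n + 4) / (n + 4) + \<tau> * (n * unit_ball_vol n * r ^ (n + 2) / (n + 2))"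
      using integral_norm_power_ball[OF r, of 4, where 'a = "real^'n"] integral_norm_power_ball[OF r, of 2, where 'a = "real^'n"]
      by (simp add: n_def)
    finally show ?thesis by (simp add: algebra_simps)
  qed
  ultimately have lim2: "(\<lambda>N. h N ^ n * (\<Sum>p\<in>lattice_ball (h N) r. F (lattice_point (h N) p)))
      \<longlonglongrightarrow> n * unit_ball_vol n * (r ^ (n + 4) / (n + 4) + \<tau> * (r ^ (n + 2) / (n + 2)))" by simp
  have "(\<Sum>j=1..k. \<Lambda> j) + \<Lambda> (Suc k) * (V / (2*pi) ^ n * (h N ^ n * card (lattice_ball (h N) r :: (int^'n) set)) - k)
      \<le> V / (2*pi) ^ n * (h N ^ n * (\<Sum>p\<in>lattice_ball (h N) r. F (lattice_point (h N) p)))" for N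
  proof -
    have "V * c / L N ^ n = V / (2*pi) ^ n * (h N ^ n * c)" "V / L N ^ n * c = V / (2*pi) ^ n * (h N ^ n * c)" for c
      using hL[of N] by (simp_all add: divide_inverse)
    moreover have "(\<Sum>j=1..k. \<Lambda> j) + \<Lambda> (Suc k) * (V * card (lattice_ball (h N) r :: (int^'n) set) / L N ^ n - k)
      \<le> V / L N ^ n * (\<Sum>p\<in>lattice_ball (h N) r. F (lattice_point (h N) p))"
      unfolding F_def V_def n_def h_def
      by (rule kroeger_lattice[OF \<tau>\<sigma> L \<Omega>(1) box]) (fact var mono u)+
    ultimately show ?thesis by simp
  qed
  then have "(\<Sum>j=1..k. \<Lambda> j) + \<Lambda> (Suc k) * (V / (2*pi) ^ n * (unit_ball_vol n * r ^ n) - k)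
      \<le> V / (2*pi) ^ n * (n * unit_ball_vol n * (r ^ (n + 4) / (n + 4) + \<tau> * (r ^ (n + 2) / (n + 2))))"
    by (intro LIMSEQ_le[OF tendsto_add[OF tendsto_const tendsto_mult[OF tendsto_const tendsto_diff[OF tendsto_mult[OF tendsto_const lim1] tendsto_const]]]
          tendsto_mult[OF tendsto_const lim2]]) auto
  then show ?thesis by (simp add: a_def V_def mult_ac)
qed

section \<open>From Kroeger's inequality to the eigenvalue bounds by choosing the radius\<close>

theorem theorem1p5:
  fixes \<Omega> :: "(real^'n::finite) set"
    and \<tau> \<sigma> :: real
    and \<Lambda> :: "nat \<Rightarrow> real"
    and u :: "nat \<Rightarrow> real^'n \<Rightarrow> real"
  assumes "2 \<le> CARD('n)"
    and "smooth_bounded_domain \<Omega>"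
    and "0 \<le> \<tau>" and "0 \<le> \<sigma>" and "\<sigma> < 1"
    and "eigenvalue_list \<Omega> \<tau> \<sigma> \<Lambda> u"
    and "variational_characterization \<Omega> \<tau> \<sigma> \<Lambda> u"
  shows "let n = CARD('n); \<omega> = unit_ball_vol (real n); V = measure lebesgue \<Omega> in
     (\<forall>k::nat. k \<ge> 1 \<longrightarrow>
        (\<Sum>j=1..k. \<Lambda> j) \<le>
          (2*pi)^4 * (n / (n + 4)) * real k powr ((n + 4) / n) * (1 / (\<omega> * V)) powr (4 / n)
          + \<tau> * (2*pi)^2 * (n / (n + 2)) * real k powr ((n + 2) / n) * (1 / (\<omega> * V)) powr (2 / n)) \<and>
     (\<tau> = 0 \<longrightarrow>
        (\<forall>k::nat. \<Lambda> (k + 1) \<le>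
          (2*pi)^4 * ((n + 4) / (4 * \<omega> * V)) powr (4 / n) * real k powr (4 / n))) \<and>
     (\<tau> > 0 \<longrightarrow>
        (\<forall>k::nat. \<Lambda> (k + 1) \<le>
          (INF r\<in>{r::real. r > 2*pi * (k / (\<omega> * V)) powr (1 / n)}.
             (n * \<omega> * V * (r^(n + 4) / (n + 4) + \<tau> * (r^(n + 2) / (n + 2))))
             / (\<omega> * V * r^n - k * (2*pi)^n))))"
proof -
  define n where "n = CARD('n)"
  define \<omega> where "\<omega> = unit_ball_vol (real n)"
  define V where "V = measure lebesgue \<Omega>"
  \<comment> \<open>Unlike the \<open>a\<close> of \<open>kroeger_bound\<close>, this one does not
    include the division by (2 pi)^n.\<close>
  define a where "a = \<omega> * V"
  have \<Omega>: "open \<Omega>" "bounded \<Omega>" "\<Omega> \<noteq> {}"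
    using assms(2) by (auto simp: smooth_bounded_domain_def)
  have n: "n > 0" by (simp add: n_def)
  have "V > 0"
    unfolding V_def zero_less_measure_iff
    using \<Omega> open_not_negligible negligible_iff_measure[of \<Omega>] lmeasurable_open by blast
  then have a: "a > 0" by (simp add: a_def \<omega>_def)
  have \<Lambda>1: "\<Lambda> 1 = 0" and incr: "\<And>j. j \<ge> 1 \<Longrightarrow> \<Lambda> j \<le> \<Lambda> (Suc j)"
    and eig: "\<And>j. j \<ge> 1 \<Longrightarrow> eigenfunction \<Omega> \<tau> \<sigma> (\<Lambda> j) (u j)"
    using assms(6) unfolding eigenvalue_list_def by blast+
  have mono: "\<Lambda> i \<le> \<Lambda> j" if "1 \<le> i" "i \<le> j" for i j
    using that(2)
  proof (induction j rule: dec_induct)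
    case (step m)
    then show ?case using \<open>1 \<le> i\<close> incr[of m] by linarith
  qed simp
  have nonneg: "0 \<le> \<Lambda> j" if "j \<ge> 1" for j using mono[of 1 j] that \<Lambda>1 by simp
  \<comment> \<open>Continuity up to the boundary makes the products of \<open>u j\<close> with
    trial functions integrable, so that orthogonality is linear in the coefficients.\<close>
  have u: "continuous_on (closure \<Omega>) (u j)" if j: "j \<ge> 1" for j
  proof -
    obtain U where "closure \<Omega> \<subseteq> U" "Ck_on 4 U (u j)"
      using eig[OF j] unfolding eigenfunction_def by blast
    then show ?thesis
      by (auto simp: numeral_eq_Suc intro: differentiable_imp_continuous_on continuous_on_subset)
  qed
  have kroeger: "(\<Sum>j=1..k. \<Lambda> j) + \<Lambda> (Suc k) * (a * r ^ n / (2*pi) ^ n - k)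
      \<le> a / (2*pi) ^ n * n * (r ^ (n + 4) / (n + 4) + \<tau> * (r ^ (n + 2) / (n + 2)))"
    if "r \<ge> 0" for r k
    using kroeger_bound[OF \<open>0 \<le> \<tau>\<close> \<open>0 \<le> \<sigma>\<close> less_imp_le[OF \<open>\<sigma> < 1\<close>] \<Omega>(1,2), of k \<Lambda> u r]
      assms(7) mono u that
    by (simp add: variational_characterization_def a_def V_def \<omega>_def n_def)
  \<comment> \<open>The base \<open>b = 0\<close> occurs in (iii) for \<open>k = 0\<close>, where
    the critical radius is 0.\<close>
  have root_power: "(2 * pi * b powr (1 / n)) ^ m = (2*pi) ^ m * b powr (m / n)" if "b \<ge> 0" "m > 0" for b m
  proof (cases "b = 0")
    case False
    then have "(b powr (1 / n)) ^ m = (b powr (1 / n)) powr m" using that by (subst powr_realpow) auto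
    then show ?thesis by (simp add: power_mult_distrib powr_powr)
  qed (use that in \<open>simp add: zero_power\<close>)
  have root_n: "(2 * pi * b powr (1 / n)) ^ n = (2*pi) ^ n * b" if "b \<ge> 0" for b
    using root_power[OF that, of n] that n by simp

  have i: "(\<Sum>j=1..k. \<Lambda> j) \<le> (2*pi)^4 * (n / (n + 4)) * real k powr ((n + 4) / n) * (1 / a) powr (4 / n)
          + \<tau> * (2*pi)^2 * (n / (n + 2)) * real k powr ((n + 2) / n) * (1 / a) powr (2 / n)"
    if k: "k \<ge> 1" for k
  proof -
    \<comment> \<open>For this radius the coefficient of \<open>\<Lambda> (Suc k)\<close> in
      \<open>kroeger\<close> is exactly 0.\<close>
    define r where "r = 2 * pi * (k / a) powr (1 / n)"
    have rn: "r ^ n = (2*pi) ^ n * (k / a)" unfolding r_def using a by (intro root_n) simp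
    have rm: "k * r ^ m = (2*pi) ^ m * (real k powr ((n + m) / n) * (1 / a) powr (m / n))" if "m > 0" for m
    proof -
      have "r ^ m = (2*pi) ^ m * (k / a) powr (m / n)" unfolding r_def using a that by (intro root_power) simp_all
      also have "(k / a) powr (m / n) = real k powr (m / n) * (1 / a) powr (m / n)"
        using a powr_mult[of k "1 / a" "m / n"] by simp
      moreover have "real k powr ((n + m) / n) = k * real k powr (m / n)"
        using n k by (simp add: add_divide_distrib powr_add)
      ultimately show ?thesis by simp
    qed
    have "(\<Sum>j=1..k. \<Lambda> j) \<le> a / (2*pi) ^ n * n * (r ^ (n + 4) / (n + 4) + \<tau> * (r ^ (n + 2) / (n + 2)))"
      using kroeger[of r k] a by (simp add: rn) (simp add: r_def)
    also have "\<dots> = n / (n + 4) * ((a / (2*pi) ^ n * r ^ n) * r ^ 4) + \<tau> * (n / (n + 2)) * ((a / (2*pi) ^ n * r ^ n) * r ^ 2)"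
      by (simp add: power_add power2_eq_square distrib_left mult_ac)
    also have "a / (2*pi) ^ n * r ^ n = k" using a by (simp add: rn)
    finally show ?thesis by (simp add: rm mult_ac)
  qed

  have ii: "\<Lambda> (Suc k) \<le> (2*pi)^4 * ((n + 4) / (4 * a)) powr (4 / n) * real k powr (4 / n)"
    if "\<tau> = 0" for k
  \<comment> \<open>For \<open>k = 0\<close> the right-hand side is 0, because
    \<open>0 powr x = 0\<close>, and the claim reduces to \<open>\<Lambda> 1 = 0\<close>.\<close>
  proof (cases "k = 0")
    case False
    \<comment> \<open>The optimal radius: with x = a b, the bound for
      \<open>\<Lambda> (Suc k)\<close> is proportional to x^(1+4/n) / (x - k). It is minimal where
      (1 + 4/n) (x - k) = x, that is, x = k (n+4)/4.\<close>
    define b where "b = (n + 4) / (4 * a) * k"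
    define r where "r = 2 * pi * b powr (1 / n)"
    have b: "b \<ge> 0" using a by (simp add: b_def)
    have rn: "r ^ n = (2*pi) ^ n * b" unfolding r_def by (rule root_n[OF b])
    have m: "a * b = m / 4 * k" if "m = real n + 4" for m using a by (simp add: b_def that)
    have ab: "a * b - k = n * k / 4" using m[OF refl] by (simp add: field_simps)
    have ab': "a * b * n / (n + 4) = n * k / 4"
    proof -
      have "a * b * n / m = n * k / 4" if "m = real n + 4" for m
      proof -
        have "m \<noteq> 0" using that by simp
        then show ?thesis unfolding m[OF that] by simp
      qed
      then show ?thesis by simp
    qed
    \<comment> \<open>Discarding the nonnegative sum leaves an estimate of
      \<open>\<Lambda> (Suc k)\<close> alone.\<close>
    have "0 \<le> (\<Sum>j=1..k. \<Lambda> j)" by (intro sum_nonneg nonneg) auto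
    then have "\<Lambda> (Suc k) * (a * b - k) \<le> a * b * n / (n + 4) * r ^ 4"
      using kroeger[of r k] by (simp add: \<open>\<tau> = 0\<close> power_add rn mult_ac) (simp add: r_def)
    then have "\<Lambda> (Suc k) * (n * k / 4) \<le> r ^ 4 * (n * k / 4)"
      unfolding ab ab' by (simp only: mult_ac)
    then have "\<Lambda> (Suc k) \<le> r ^ 4" using False n by simp
    also have "r ^ 4 = (2*pi)^4 * (b powr (4 / n))" unfolding r_def using root_power[OF b, of 4] by simp
    also have "b powr (4 / n) = ((n + 4) / (4 * a)) powr (4 / n) * real k powr (4 / n)"
      unfolding b_def by (rule powr_mult)
    finally show ?thesis by (simp only: mult.assoc)
  qed (use \<Lambda>1 in simp)

  have iii: "\<Lambda> (Suc k) \<le> (INF r\<in>{r. r > 2 * pi * (k / a) powr (1 / n)}.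
      n * a * (r^(n + 4) / (n + 4) + \<tau> * (r^(n + 2) / (n + 2))) / (a * r^n - k * (2*pi)^n))" for k
  proof (rule cINF_greatest)
    show "{r. r > 2 * pi * (k / a) powr (1 / n)} \<noteq> {}" by (auto intro: gt_ex)
    fix r assume "r \<in> {r. r > 2 * pi * (k / a) powr (1 / n)}"
    then have r: "2 * pi * (k / a) powr (1 / n) < r" by simp
    have r0: "0 \<le> 2 * pi * (k / a) powr (1 / n)" by simp
    \<comment> \<open>The strict lower bound on \<open>r\<close> makes the denominator positive, so
      the inequality can be divided by it.\<close>
    have "(2*pi) ^ n * (k / a) = (2 * pi * (k / a) powr (1 / n)) ^ n"
      using a by (intro root_n[symmetric]) simp
    also have "\<dots> < r ^ n" using r r0 n by (rule power_strict_mono)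
    finally have pos: "0 < a * r ^ n - k * (2*pi) ^ n" using a by (simp add: field_simps)
    have "0 \<le> (\<Sum>j=1..k. \<Lambda> j)" by (intro sum_nonneg nonneg) auto
    then have "\<Lambda> (Suc k) * (a * r ^ n / (2*pi) ^ n - k)
      \<le> a / (2*pi) ^ n * n * (r ^ (n + 4) / (n + 4) + \<tau> * (r ^ (n + 2) / (n + 2)))"
      using kroeger[of r k] r r0 by linarith
    then have "(2*pi) ^ n * (\<Lambda> (Suc k) * (a * r ^ n / (2*pi) ^ n - k))
      \<le> (2*pi) ^ n * (a / (2*pi) ^ n * n * (r ^ (n + 4) / (n + 4) + \<tau> * (r ^ (n + 2) / (n + 2))))"
      by (intro mult_left_mono) auto
    then have "\<Lambda> (Suc k) * (a * r ^ n - k * (2*pi) ^ n) \<le> n * a * (r^(n + 4) / (n + 4) + \<tau> * (r^(n + 2) / (n + 2)))"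
      by (simp add: right_diff_distrib mult_ac)
    then show "\<Lambda> (Suc k) \<le> n * a * (r^(n + 4) / (n + 4) + \<tau> * (r^(n + 2) / (n + 2))) / (a * r^n - k * (2*pi)^n)"
      using pos by (simp add: pos_le_divide_eq)
  qed

  show ?thesis
    unfolding Let_def n_def[symmetric] \<omega>_def[symmetric] V_def[symmetric]
    using i ii iii by (simp add: a_def mult.assoc)
qed

end
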